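(* Let $m\ge 2$, let $\mathbb{I}$ be $\mathbb{Q}$ or an imaginary quadratic field with ring of integers $\mathbb{Z}_{\mathbb{I}}$, and let $\alpha_0=0,\alpha_1,\dots,\alpha_m$ be $m+1$ different numbers of $\mathbb{I}$. With $E$, $H_0$ and $\xi(z,H)$ the quantities attached to $\overline\alpha=(\alpha_0,\dots,\alpha_m)^T$ and $\mathbb{I}$ in the context, one has $$\left|\beta_0+\beta_1 e^{\alpha_1}+\cdots+\beta_me^{\alpha_m}\right|>\frac{1}{2e^{E}H^{1+\epsilon(H)}},\qquad \epsilon(H)=\xi(z,H),$$ for all $\overline\beta=(\beta_0,\beta_1,\dots,\beta_m)^T\in\mathbb{Z}_{\mathbb{I}}^{m+1}\setminus\{\overline 0\}$ and all real $H_1,\dots,H_m$ with $H_i\ge h_i=\max\{1,|\beta_i|\}$ such that $$H=\prod_{i=1}^m(2mH_i)\ge H_0 .$$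
   Context: Write $\alpha_j=x_j/y_j$ with $x_j\in\mathbb{Z}_{\mathbb{I}}$, $y_j\in\mathbb{Z}^+$, $\gcd(x_j,y_j)=1$ in the sense that no rational integer $>1$ divides both (so $y_j$ is the least positive integer with $y_j\alpha_j\in\mathbb{Z}_{\mathbb{I}}$), $j=0,\dots,m$. Put $$g_1=\operatorname{lcm}(y_0,\dots,y_m),\quad g_2=\max_{0\le j\le m}\{|x_j|+|y_j|\},\quad g_3=\max_{0\le j\le m}|\alpha_j|,\quad g_4=\max_{1\le j\le m}\Bigl\{1+\tfrac{|y_j|}{|x_j|}\Bigr\},$$ $$b_0=\sqrt{\log g_2}+\frac{\log g_4}{2\sqrt{\log g_2}},\quad e_0=3\sqrt{\log g_2}+\frac{\log g_4}{2\sqrt{\log g_2}},$$ $$b_1=\max\{0,\log g_1-\log g_2-\log g_4\},\quad e_1=\max\{0,\log g_1+2\log(1+g_3)+2\log2+1-\log g_2-\log g_4\},$$ $$A=b_0+e_0m,\quad B=1+b_0+b_1+e_1m,\quad C=m,\quad D=b_0m+e_0m^2,\quad E=(1+b_0+b_1)m+(2e_0+e_1)m^2.$$ Let $z(\cdot)$, defined on $[e,\infty)$, be the inverse function of $y(z)=z\log z$, $z\ge e$, and put $$\xi(z,H)=A\left(2\frac{z(2\log H)}{\log H}\right)^{1/2}+B\frac{z(2\log H)}{\log H}+C\frac{\log z(2\log H)}{\log H}+D\frac{(\log z(2\log H))^{1/2}}{\log H}.$$ Constants $s_{\mathbb{I}},t_{\mathbb{I}}$: $s_{\mathbb{Q}}=t_{\mathbb{Q}}=1$;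 for $\mathbb{I}=\mathbb{Q}(\sqrt{-d})$ with $d$ a squarefree positive integer, $t_{\mathbb{I}}=\frac{5}{2\sqrt2}$, and $s_{\mathbb{I}}=\frac{2\sqrt2\,d^{1/4}}{\sqrt\pi}$ if $d\equiv1,2\pmod 4$, $s_{\mathbb{I}}=\frac{2}{\sqrt\pi}d^{1/4}$ if $d\equiv3\pmod4$. Finally $$H_0=\max\Bigl\{e^{(\gamma\log\gamma)/2},\,2\log\frac{s_{\mathbb{I}}}{t_{\mathbb{I}}}\Bigr\},\qquad \log\gamma=(3me_0)^2 .$$ *)

theory Defs
  imports Complex_Main "HOL-Computational_Algebra.Computational_Algebra"
begin

datatype base_field = Rational_Field | Imaginary_Quadratic nat

text \<open>\<open>Imaginary_Quadratic d\<close> stands for the field generated by the square root of \<open>-d\<close>;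
  it is only meaningful under \<open>valid_field\<close>.\<close>

fun valid_field :: "base_field \<Rightarrow> bool" where
  "valid_field Rational_Field = True"
| "valid_field (Imaginary_Quadratic d) = (d > 0 \<and> squarefree d)"

fun field_elems :: "base_field \<Rightarrow> complex set" where
  "field_elems Rational_Field = \<rat>"
| "field_elems (Imaginary_Quadratic d) =
     {of_rat a + of_rat b * (\<i> * complex_of_real (sqrt (real d))) | a b. True}"

definition field_integers :: "base_field \<Rightarrow> complex set" where
  "field_integers K = {u \<in> field_elems K. algebraic_int u}"

text \<open>For squarefree \<open>d\<close> the last case is exactly \<open>d\<close> congruent to 1 or 2 modulo 4.\<close>

fun s_const :: "base_field \<Rightarrow> real" where
  "s_const Rational_Field = 1"
| "s_const (Imaginary_Quadratic d) =
     (if d mod 4 = 3 then 2 / sqrt pi * root 4 (real d)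
      else 2 * sqrt 2 * root 4 (real d) / sqrt pi)"

fun t_const :: "base_field \<Rightarrow> real" where
  "t_const Rational_Field = 1"
| "t_const (Imaginary_Quadratic d) = 5 / (2 * sqrt 2)"

text \<open>Coprimality only excludes common divisors that are rational integers; divisibility of
  \<open>x\<close> is meant in the ring of integers of \<open>K\<close>.\<close>

definition reduced_fraction :: "base_field \<Rightarrow> complex \<Rightarrow> complex \<Rightarrow> nat \<Rightarrow> bool" where
  "reduced_fraction K a x y \<longleftrightarrow>
     x \<in> field_integers K \<and> y > 0 \<and> a = x / of_nat y \<and>
     \<not> (\<exists>n::nat. n > 1 \<and> n dvd y \<and> (\<exists>w \<in> field_integers K. x = of_nat n * w))"

definition g1 :: "nat \<Rightarrow> (nat \<Rightarrow> nat) \<Rightarrow> real" where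
  "g1 m y = real (Lcm (y ` {0..m}))"

definition g2 :: "nat \<Rightarrow> (nat \<Rightarrow> complex) \<Rightarrow> (nat \<Rightarrow> nat) \<Rightarrow> real" where
  "g2 m x y = Max ((\<lambda>j. cmod (x j) + real (y j)) ` {0..m})"

definition g3 :: "nat \<Rightarrow> (nat \<Rightarrow> complex) \<Rightarrow> real" where
  "g3 m \<alpha> = Max ((\<lambda>j. cmod (\<alpha> j)) ` {0..m})"

definition g4 :: "nat \<Rightarrow> (nat \<Rightarrow> complex) \<Rightarrow> (nat \<Rightarrow> nat) \<Rightarrow> real" where
  "g4 m x y = Max ((\<lambda>j. 1 + real (y j) / cmod (x j)) ` {1..m})"

definition b0 :: "nat \<Rightarrow> (nat \<Rightarrow> complex) \<Rightarrow> (nat \<Rightarrow> nat) \<Rightarrow> real" where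
  "b0 m x y = sqrt (ln (g2 m x y)) + ln (g4 m x y) / (2 * sqrt (ln (g2 m x y)))"

definition e0 :: "nat \<Rightarrow> (nat \<Rightarrow> complex) \<Rightarrow> (nat \<Rightarrow> nat) \<Rightarrow> real" where
  "e0 m x y = 3 * sqrt (ln (g2 m x y)) + ln (g4 m x y) / (2 * sqrt (ln (g2 m x y)))"

definition b1 :: "nat \<Rightarrow> (nat \<Rightarrow> complex) \<Rightarrow> (nat \<Rightarrow> nat) \<Rightarrow> real" where
  "b1 m x y = max 0 (ln (g1 m y) - ln (g2 m x y) - ln (g4 m x y))"

definition e1 ::
  "nat \<Rightarrow> (nat \<Rightarrow> complex) \<Rightarrow> (nat \<Rightarrow> complex) \<Rightarrow> (nat \<Rightarrow> nat) \<Rightarrow> real" where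
  "e1 m \<alpha> x y =
     max 0 (ln (g1 m y) + 2 * ln (1 + g3 m \<alpha>) + 2 * ln 2 + 1 - ln (g2 m x y) - ln (g4 m x y))"

definition A_const :: "nat \<Rightarrow> (nat \<Rightarrow> complex) \<Rightarrow> (nat \<Rightarrow> nat) \<Rightarrow> real" where
  "A_const m x y = b0 m x y + e0 m x y * real m"

definition B_const ::
  "nat \<Rightarrow> (nat \<Rightarrow> complex) \<Rightarrow> (nat \<Rightarrow> complex) \<Rightarrow> (nat \<Rightarrow> nat) \<Rightarrow> real" where
  "B_const m \<alpha> x y = 1 + b0 m x y + b1 m x y + e1 m \<alpha> x y * real m"

definition C_const :: "nat \<Rightarrow> real" where
  "C_const m = real m"

definition D_const :: "nat \<Rightarrow> (nat \<Rightarrow> complex) \<Rightarrow> (nat \<Rightarrow> nat) \<Rightarrow> real" where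
  "D_const m x y = b0 m x y * real m + e0 m x y * (real m)\<^sup>2"

definition E_const ::
  "nat \<Rightarrow> (nat \<Rightarrow> complex) \<Rightarrow> (nat \<Rightarrow> complex) \<Rightarrow> (nat \<Rightarrow> nat) \<Rightarrow> real" where
  "E_const m \<alpha> x y =
     (1 + b0 m x y + b1 m x y) * real m + (2 * e0 m x y + e1 m \<alpha> x y) * (real m)\<^sup>2"

text \<open>Only meaningful for arguments at least \<open>e\<close>, where the preimage exists and is unique.\<close>

definition z_fun :: "real \<Rightarrow> real" where
  "z_fun = the_inv_into {exp 1..} (\<lambda>z. z * ln z)"

definition xi ::
  "nat \<Rightarrow> (nat \<Rightarrow> complex) \<Rightarrow> (nat \<Rightarrow> complex) \<Rightarrow> (nat \<Rightarrow> nat) \<Rightarrow> real \<Rightarrow> real" where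
  "xi m \<alpha> x y H =
     A_const m x y * sqrt (2 * (z_fun (2 * ln H) / ln H))
     + B_const m \<alpha> x y * (z_fun (2 * ln H) / ln H)
     + C_const m * (ln (z_fun (2 * ln H)) / ln H)
     + D_const m x y * (sqrt (ln (z_fun (2 * ln H))) / ln H)"

definition gamma_const :: "nat \<Rightarrow> (nat \<Rightarrow> complex) \<Rightarrow> (nat \<Rightarrow> nat) \<Rightarrow> real" where
  "gamma_const m x y = exp ((3 * real m * e0 m x y)\<^sup>2)"

definition H0 :: "base_field \<Rightarrow> nat \<Rightarrow> (nat \<Rightarrow> complex) \<Rightarrow> (nat \<Rightarrow> nat) \<Rightarrow> real" where
  "H0 K m x y =
     max (exp (gamma_const m x y * ln (gamma_const m x y) / 2))
         (2 * ln (s_const K / t_const K))"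

end

theory Submission
  imports Defs "HOL-Analysis.Analysis" "Jordan_Normal_Form.Determinant"
begin

hide_const (open) Determinants.det Finite_Cartesian_Product.mat module.smult

text \<open>
  Siegel's lemma over the ring of integers yields a polynomial \<open>A 0\<close> of degree at most \<open>L\<close>, not zero,
  such that the coefficients of index \<open>L + 1, \<dots>, L + l j\<close> in \<open>A 0(t) exp(\<alpha> j t)\<close> vanish. Truncation at
  degree \<open>L\<close> gives simultaneous approximations \<open>A j(t) / A 0(t)\<close> of \<open>exp(\<alpha> j t)\<close>, and differentiating gives
  further ones; a Wronskian argument shows that some derivative of small order produces at \<open>t = 1\<close> a
  nonzero integral value of the linear form. The \<open>l j\<close> are adapted to the \<open>Hs j\<close>, so that each remainder
  is at most \<open>1 / (2 m Hs j)\<close>. Then half of the integral value comes from the linear form itself, whose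
  absolute value is therefore at least the inverse of twice the common denominator. Taking
  \<open>s L / sqrt (ln L)\<close> with \<open>s = sqrt (ln g2)\<close> as the excess of unknowns over equations in Siegel's
  lemma balances the size of the solution against the loss in vanishing order.
\<close>

section \<open>Orders in imaginary quadratic fields\<close>

text \<open>The order Z + Z \<open>\<omega>\<close> need not be maximal: what matters is that it is
  a ring containing the ring of integers, that its nonzero elements have modulus at least 1, and
  that its cells have area \<open>h\<close>. Rational integers are therefore treated inside Z[i].
  The obstacle is the factor \<open>10 * (1 + h)\<close> in Siegel's lemma, because E and xi do not
  depend on the field. If \<open>h \<le> g2\<close> it is at most \<open>20 * g2\<close> and is
  absorbed. Otherwise every \<open>x j\<close> is too short to be nonreal, and a form over the
  rational integers takes over. The constants are a ledger of logarithms. Write s^2 = ln g2 and lam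
  = ln g4. The logarithms of the row norms in Siegel's lemma add up to at most L^2 (s^2 + lam / 2);
  dividing by the excess s L / sqrt(ln L) gives b0 L sqrt(ln L). The vanishing order lost, once to
  the excess and once for each j to the derivatives, costs about (m + 1) s L sqrt(ln L). Together
  with m b0 L sqrt(ln L) from the m remainders this fits below m e0 L sqrt(ln L), as e0 = b0 + 2 s.
  Small remainders thus force L ln L to be ln H plus these terms, and the factor L! in the common
  denominator turns L ln L into the exponent of H.\<close>

locale quadratic_order =
  fixes \<omega> :: complex and tr nm :: int
  assumes Im_omega_pos: "Im \<omega> > 0"
    and omega_trace: "\<omega> + cnj \<omega> = of_int tr"
    and omega_norm: "\<omega> * cnj \<omega> = of_int nm"
begin

definition R :: "complex set" where
  "R = {of_int a + of_int b * \<omega> | a b. True}"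

abbreviation h :: real where "h \<equiv> Im \<omega>"

lemma R_I: "of_int a + of_int b * \<omega> \<in> R"
  unfolding R_def by blast

lemma R_E:
  assumes "p \<in> R"
  obtains a b where "p = of_int a + of_int b * \<omega>"
  using assms unfolding R_def by blast

lemma R_of_int [simp, intro]: "of_int a \<in> R"
  using R_I[of a 0] by simp

lemma R_of_nat [simp, intro]: "of_nat n \<in> R"
  using R_of_int[of "int n"] by simp

lemma R_0 [simp, intro]: "0 \<in> R" and R_1 [simp, intro]: "1 \<in> R"
  using R_of_int[of 0] R_of_int[of 1] by simp_all

lemma R_add [intro]:
  assumes "p \<in> R" "q \<in> R" shows "p + q \<in> R"
proof -
  obtain a b c d where "p = of_int a + of_int b * \<omega>" "q = of_int c + of_int d * \<omega>"
    using assms by (metis R_E)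
  then have "p + q = of_int (a + c) + of_int (b + d) * \<omega>"
    by (simp add: algebra_simps)
  then show ?thesis using R_I by metis
qed

lemma omega_square: "\<omega> * \<omega> = of_int tr * \<omega> - of_int nm"
  using omega_trace[symmetric] omega_norm[symmetric] by (simp add: algebra_simps)

lemma R_mult [intro]:
  assumes "p \<in> R" "q \<in> R" shows "p * q \<in> R"
proof -
  obtain a b c d where pq: "p = of_int a + of_int b * \<omega>" "q = of_int c + of_int d * \<omega>"
    using assms by (metis R_E)
  have "p * q = of_int a * of_int c + (of_int a * of_int d + of_int b * of_int c) * \<omega>
      + of_int b * of_int d * (\<omega> * \<omega>)"
    unfolding pq by (simp add: algebra_simps)
  also have "\<dots> = of_int (a * c - b * d * nm) + of_int (a * d + b * c + b * d * tr) * \<omega>"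
    unfolding omega_square by (simp add: algebra_simps)
  finally show ?thesis using R_I by metis
qed

lemma R_minus [intro]:
  assumes "p \<in> R" shows "- p \<in> R"
  using R_mult[OF R_of_int[of "-1"] assms] by simp

lemma R_diff [intro]:
  assumes "p \<in> R" "q \<in> R" shows "p - q \<in> R"
  using R_add[OF assms(1) R_minus[OF assms(2)]] by simp

lemma R_power [intro]: "p \<in> R \<Longrightarrow> p ^ n \<in> R"
  by (induction n) auto

lemma R_sum [intro]: "(\<And>i. i \<in> I \<Longrightarrow> f i \<in> R) \<Longrightarrow> sum f I \<in> R"
  by (induction I rule: infinite_finite_induct) auto

text \<open>The squared modulus is p times its conjugate, an integral quadratic form in the
  coordinates by trace and norm of \<open>\<omega>\<close>, hence a positive rational integer. This
  is the arithmetic input of the whole lower bound.\<close>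

lemma cmod_ge_1:
  assumes "p \<in> R" "p \<noteq> 0" shows "cmod p \<ge> 1"
proof -
  obtain a b where p: "p = of_int a + of_int b * \<omega>" using assms(1) by (rule R_E)
  have "complex_of_real ((cmod p)\<^sup>2) = p * cnj p"
    by (rule complex_norm_square)
  also have "\<dots> = of_int a * of_int a + of_int a * of_int b * (\<omega> + cnj \<omega>)
      + of_int b * of_int b * (\<omega> * cnj \<omega>)"
    unfolding p by (simp add: algebra_simps)
  also have "\<dots> = complex_of_real (of_int (a * a + a * b * tr + b * b * nm))"
    unfolding omega_trace omega_norm by simp
  finally have eq: "(cmod p)\<^sup>2 = of_int (a * a + a * b * tr + b * b * nm)"
    by (simp only: of_real_eq_iff)
  moreover have "(cmod p)\<^sup>2 > 0" using assms(2) by simp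
  ultimately have "a * a + a * b * tr + b * b * nm \<ge> 1"
    by (metis of_int_0_less_iff int_one_le_iff_zero_less)
  then have "(cmod p)\<^sup>2 \<ge> 1\<^sup>2" unfolding eq power_one by (metis of_int_1_le_iff)
  then show ?thesis by (rule power2_le_imp_le) simp
qed

lemma Im_R:
  assumes "p \<in> R" shows "\<exists>k::int. Im p = of_int k * h"
  using assms by (elim R_E) auto

lemma Im_0_R:
  assumes "p \<in> R" "Im p = 0" obtains k where "p = of_int k"
proof -
  obtain a b where p: "p = of_int a + of_int b * \<omega>" using assms(1) by (rule R_E)
  then have "b = 0" using assms(2) Im_omega_pos by auto
  then show ?thesis using p that by simp
qed

end

section \<open>Algebraic integers of imaginary quadratic fields\<close>

lemma map_poly_of_int_add:
  "map_poly of_int (p + q) = map_poly of_int p + (map_poly of_int q :: 'a::ring_1 poly)"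
  by (intro poly_eqI) (simp add: coeff_map_poly)

lemma map_poly_of_int_mult:
  "map_poly of_int (p * q) = map_poly of_int p * (map_poly of_int q :: 'a::comm_ring_1 poly)"
  by (intro poly_eqI) (simp add: coeff_map_poly coeff_mult)

text \<open>Gauss's lemma: the primitive integral multiple of the minimal polynomial of a nonreal u
  divides a monic integral polynomial, so its leading coefficient is a unit and trace and norm are
  integers.\<close>

lemma algebraic_int_quadratic:
  fixes u :: complex
  assumes alg: "algebraic_int u" and Im: "Im u \<noteq> 0"
    and tr: "u + cnj u \<in> \<rat>" and nm: "u * cnj u \<in> \<rat>"
  shows "u + cnj u \<in> \<int> \<and> u * cnj u \<in> \<int>"
proof -
  obtain p :: "int poly" where p: "poly (map_poly of_int p) u = 0" "lead_coeff p = 1"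
    using alg unfolding algebraic_int_altdef_ipoly by blast
  obtain t1 t2 where t: "u + cnj u = of_int t1 / of_int t2" "t2 > 0"
    using tr by (rule Rats_cases')
  obtain n1 n2 where n: "u * cnj u = of_int n1 / of_int n2" "n2 > 0"
    using nm by (rule Rats_cases')
  \<comment> \<open>This is \<open>t2 * n2\<close> times the polynomial X^2 - trace X + norm, with
    all denominators cleared.\<close>
  define Q0 where "Q0 = [:n1 * t2, - (t1 * n2), t2 * n2:]"
  define Q where "Q = primitive_part Q0"
  have usq: "u * u = (u + cnj u) * u - u * cnj u" by (simp add: algebra_simps)
  have Q0u: "poly (map_poly of_int Q0) u = 0"
  proof -
    have "poly (map_poly of_int Q0) u
        = of_int t2 * of_int n2 * (u * u - of_int t1 / of_int t2 * u + of_int n1 / of_int n2)"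
      using t(2) n(2) unfolding Q0_def
      by (simp add: map_poly_pCons field_simps)
    also have "u * u = of_int t1 / of_int t2 * u - of_int n1 / of_int n2"
      unfolding t(1)[symmetric] n(1)[symmetric] by (rule usq)
    finally show ?thesis by simp
  qed
  have Q0nz: "Q0 \<noteq> 0" using t n by (simp add: Q0_def)
  have cQ0: "Q0 = smult (Polynomial.content Q0) Q" unfolding Q_def by simp
  have contQ0: "Polynomial.content Q0 \<noteq> 0" using Q0nz by simp
  have degQ: "degree Q = 2"
    using t n unfolding Q_def by (simp add: Q0_def)
  have "poly (map_poly of_int Q0) u = of_int (Polynomial.content Q0) * poly (map_poly of_int Q) u"
    by (subst cQ0, subst map_poly_smult) simp_all
  then have Qu: "poly (map_poly of_int Q) u = (0::complex)" using Q0u contQ0 by simp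
  have Qnz: "Q \<noteq> 0" using degQ by auto
  define c where "c = lead_coeff Q"
  have cnz: "c \<noteq> 0" using Qnz by (simp add: c_def)
  \<comment> \<open>Pseudo-division stays over the integers. The remainder has degree at most 1 and
    real coefficients and vanishes at a nonreal point, so it is zero; only the power
    \<open>c ^ e\<close> then remains to be cancelled.\<close>
  obtain S r where Sr: "pseudo_divmod p Q = (S, r)" by fastforce
  define e where "e = Suc (degree p) - degree Q"
  have eq: "smult (c ^ e) p = Q * S + r" and rdeg: "r = 0 \<or> degree r < degree Q"
    using pseudo_divmod(1)[OF Qnz Sr] pseudo_divmod(2)[OF Qnz Sr] by (simp_all add: c_def e_def)
  have "poly (map_poly of_int (smult (c ^ e) p)) u = (0::complex)"
    using p(1) by (simp add: map_poly_smult)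
  then have ru: "poly (map_poly of_int r) u = 0"
    unfolding eq using Qu by (simp add: map_poly_of_int_add map_poly_of_int_mult)
  have "degree r \<le> 1" using rdeg degQ by auto
  define r0 r1 where "r0 = coeff r 0" and "r1 = coeff r 1"
  have r: "r = [:r0, r1:]"
    using \<open>degree r \<le> 1\<close> unfolding r0_def r1_def
    by (intro poly_eqI) (auto simp: coeff_pCons coeff_eq_0 split: nat.splits)
  have "of_int r0 + of_int r1 * u = 0" using ru unfolding r
    by (simp add: map_poly_pCons mult.commute)
  then have "Im (of_int r0 + of_int r1 * u) = 0" "Re (of_int r0 + of_int r1 * u) = 0" by simp_all
  then have "r = 0" using Im unfolding r by simp
  then have eq': "smult (c ^ e) p = Q * S" using eq by simp
  \<comment> \<open>Both p and Q are primitive, so the content of S equals \<open>c ^ e\<close> up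
    to sign. Hence \<open>c ^ e\<close> divides S coefficientwise and cancels.\<close>
  have contp: "Polynomial.content p = 1"
    using p(2) content_dvd_coeff[of p "degree p"] by (metis is_unit_content_iff)
  have "Polynomial.content Q = 1" using Q0nz unfolding Q_def by simp
  then have "Polynomial.content S = normalize (c ^ e)"
    using arg_cong[OF eq', of Polynomial.content] contp by (simp add: content_mult)
  then have "\<bar>c ^ e\<bar> = Polynomial.content S" by simp
  then obtain w where w: "Polynomial.content S = c ^ e * w" "w = 1 \<or> w = -1"
    by (metis abs_if mult.right_neutral mult_minus1_right)
  define S' where "S' = smult w (primitive_part S)"
  have "S = smult (c ^ e) S'"
    unfolding S'_def using content_times_primitive_part[of S] w(1) by simp
  then have "smult (c ^ e) p = smult (c ^ e) (Q * S')" using eq' by simp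
  then have "c ^ e * coeff p n = c ^ e * coeff (Q * S') n" for n
    by (metis coeff_smult)
  then have "p = Q * S'" using cnz by (intro poly_eqI) simp
  then have "lead_coeff p = c * lead_coeff S'" by (simp add: lead_coeff_mult c_def)
  then have "c dvd 1" using p(2) by (metis dvd_triv_left)
  then have c1: "c = 1 \<or> c = -1" by (simp add: abs_if split: if_splits)
  define k where "k = Polynomial.content Q0"
  have Q0': "Q0 = smult k Q" using cQ0 by (simp add: k_def)
  have k0: "k \<noteq> 0" using contQ0 by (simp add: k_def)
  have e2: "t2 * n2 = k * c" using arg_cong[OF Q0', of "\<lambda>q. coeff q 2"] degQ
    by (simp add: Q0_def c_def numeral_2_eq_2)
  have e1: "- (t1 * n2) = k * coeff Q 1" using arg_cong[OF Q0', of "\<lambda>q. coeff q 1"]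
    by (simp add: Q0_def)
  have e0: "n1 * t2 = k * coeff Q 0" using arg_cong[OF Q0', of "\<lambda>q. coeff q 0"]
    by (simp add: Q0_def)
  have "u + cnj u = of_int (t1 * n2) / of_int (t2 * n2)" using t n by simp
  also have "t1 * n2 = k * (- coeff Q 1)" using e1 by simp
  also have "of_int (k * (- coeff Q 1)) / of_int (t2 * n2) = (of_int (- c * coeff Q 1) :: complex)"
    unfolding e2 using k0 c1 by auto
  finally have T: "u + cnj u \<in> \<int>" by simp
  have "u * cnj u = of_int (n1 * t2) / of_int (t2 * n2)" using t n by simp
  also have "\<dots> = (of_int (c * coeff Q 0) :: complex)"
    unfolding e2 e0 using k0 c1 by auto
  finally have "u * cnj u \<in> \<int>" by simp
  with T show ?thesis by simp
qed

text \<open>In lowest terms, the square of the denominator of b would have to divide d.\<close>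

lemma squarefree_rat_square:
  fixes b :: rat and d :: nat
  assumes sf: "squarefree d" and int: "of_nat d * b\<^sup>2 \<in> \<int>"
  shows "b \<in> \<int>"
proof -
  obtain p q where pq: "quotient_of b = (p, q)" by fastforce
  have b: "b = of_int p / of_int q" and q: "q > 0" and cop: "coprime p q"
    using quotient_of_div[OF pq] quotient_of_denom_pos[OF pq] quotient_of_coprime[OF pq] by auto
  obtain k :: int where k: "of_nat d * b\<^sup>2 = of_int k" using int by (elim Ints_cases)
  have "(of_int (int d * p\<^sup>2) :: rat) = of_int (k * q\<^sup>2)"
    using k q unfolding b by (simp add: field_simps)
  then have eq: "int d * p\<^sup>2 = k * q\<^sup>2" by (simp only: of_int_eq_iff)
  have "coprime (q\<^sup>2) (p\<^sup>2)" using cop by (simp add: coprime_commute)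
  then have "q\<^sup>2 dvd int d" using eq by (metis coprime_dvd_mult_left_iff dvd_triv_right)
  then have "(nat q)\<^sup>2 dvd d" using q by (metis int_dvd_int_iff int_nat_eq of_nat_power order_less_imp_le)
  then have "nat q dvd 1" using sf by (auto simp: squarefree_def)
  then have "q = 1" using q by simp
  then show ?thesis using b by simp
qed

lemma of_real_of_rat: "of_real (of_rat r) = (of_rat r :: 'a::{real_div_algebra,field_char_0})"
  by (cases r) (simp add: of_rat_rat)

lemma of_rat_in_Ints_iff: "(of_rat r :: 'a::field_char_0) \<in> \<int> \<longleftrightarrow> r \<in> \<int>"
proof
  assume "(of_rat r :: 'a) \<in> \<int>"
  then obtain k where "(of_rat r :: 'a) = of_int k" by (elim Ints_cases)
  then have "(of_rat r :: 'a) = of_rat (of_int k)" by simp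
  then show "r \<in> \<int>" by (simp only: of_rat_eq_iff) simp
qed (auto elim!: Ints_cases)

lemma field_integers_Rational:
  "u \<in> field_integers Rational_Field \<Longrightarrow> u \<in> \<int>"
  unfolding field_integers_def by (auto intro: rational_algebraic_int_is_int)

definition order_gen :: "nat \<Rightarrow> complex" where
  "order_gen d = (if d mod 4 = 3 then (1 + \<i> * sqrt d) / 2 else \<i> * sqrt d)"

lemma quadratic_order_order_gen:
  assumes "d > 0"
  shows "quadratic_order (order_gen d) (if d mod 4 = 3 then 1 else 0)
           (if d mod 4 = 3 then (1 + int d) div 4 else int d)"
proof (cases "d mod 4 = 3")
  case True
  have "4 dvd 1 + int d" using True by presburger
  then have e: "complex_of_int ((1 + int d) div 4) = (1 + of_nat d) / 4"
    by (subst of_int_div) auto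
  have "complex_of_real (sqrt d) * complex_of_real (sqrt d) = of_nat d"
    by (simp flip: of_real_mult)
  then show ?thesis using True assms
    by unfold_locales (simp_all add: order_gen_def e field_simps)
next
  case False
  have "\<i> * complex_of_real (sqrt d) * (\<i> * complex_of_real (sqrt d)) = - of_nat d"
    by (simp add: complex_eq_iff)
  then show ?thesis using assms False
    by unfold_locales (simp_all add: order_gen_def)
qed

text \<open>Integrality of the trace 2a and the norm a^2 + d b^2 makes d (2b)^2 integral, hence 2b
  integral as d is squarefree. The numerators A', B' of a, b over 2 satisfy 4 | A'^2 + d B'^2, and
  since squares are 0 or 1 modulo 4 this decides their parities.\<close>

lemma field_integers_subset_R:
  assumes d: "d > 0" "squarefree d"
    and u: "u \<in> field_integers (Imaginary_Quadratic d)"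
  shows "u \<in> quadratic_order.R (order_gen d)"
proof -
  interpret quadratic_order "order_gen d" "if d mod 4 = 3 then 1 else 0"
      "if d mod 4 = 3 then (1 + int d) div 4 else int d"
    using quadratic_order_order_gen[OF d(1)] .
  obtain a b where ab: "u = of_rat a + of_rat b * (\<i> * complex_of_real (sqrt d))"
    and alg: "algebraic_int u"
    using u unfolding field_integers_def by auto
  have or1: "(of_rat a :: complex) = of_real (of_rat a)" "(of_rat b :: complex) = of_real (of_rat b)"
    by (simp_all only: of_real_of_rat)
  have Im_u: "Im u = of_rat b * sqrt d" and Re_u: "Re u = of_rat a"
    unfolding ab or1 by simp_all
  show ?thesis
  proof (cases "b = 0")
    case True
    then have "u \<in> \<rat>" using ab by simp
    then have "u \<in> \<int>" using alg by (rule rational_algebraic_int_is_int[rotated])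
    then show ?thesis by (auto elim: Ints_cases)
  next
    case False
    have s: "sqrt d * sqrt d = real d" by simp
    have t: "u + cnj u = of_rat (2 * a)"
      by (subst complex_add_cnj) (simp add: Re_u of_rat_mult of_real_of_rat)
    have "u * cnj u = of_real ((Re u)\<^sup>2 + (Im u)\<^sup>2)"
      by (subst complex_mult_cnj) simp
    also have "\<dots> = of_rat (a\<^sup>2 + of_nat d * b\<^sup>2)"
      by (simp add: Re_u Im_u of_rat_add of_rat_mult power_mult_distrib of_rat_power of_real_of_rat mult.commute)
    finally have n: "u * cnj u = of_rat (a\<^sup>2 + of_nat d * b\<^sup>2)" .
    have "Im u \<noteq> 0" using False d by (simp add: Im_u)
    then have "u + cnj u \<in> \<int> \<and> u * cnj u \<in> \<int>"
      using alg by (intro algebraic_int_quadratic) (simp_all add: t n)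
    then have A: "2 * a \<in> \<int>" and N: "a\<^sup>2 + of_nat d * b\<^sup>2 \<in> \<int>"
      unfolding t n of_rat_in_Ints_iff by blast+
    have "of_nat d * (2 * b)\<^sup>2 = 4 * (a\<^sup>2 + of_nat d * b\<^sup>2) - (2 * a)\<^sup>2"
      by (simp add: power2_eq_square algebra_simps)
    also have "\<dots> \<in> \<int>" by (intro Ints_diff Ints_mult[OF Ints_numeral] Ints_power A N)
    finally have "2 * b \<in> \<int>" by (rule squarefree_rat_square[OF d(2)])
    then obtain A' B' N' :: int where AB: "2 * a = of_int A'" "2 * b = of_int B'"
        "a\<^sup>2 + of_nat d * b\<^sup>2 = of_int N'"
      using A N by (metis Ints_cases)
    have "(of_int (4 * N') :: rat) = (2 * a)\<^sup>2 + of_nat d * (2 * b)\<^sup>2"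
      unfolding of_int_mult AB(3)[symmetric] by (simp add: power2_eq_square algebra_simps)
    also have "\<dots> = of_int (A'\<^sup>2 + int d * B'\<^sup>2)"
      unfolding AB by simp
    finally have "(of_int (4 * N') :: rat) = of_int (A'\<^sup>2 + int d * B'\<^sup>2)" .
    then have "4 * N' = A'\<^sup>2 + int d * B'\<^sup>2" by (simp only: of_int_eq_iff)
    then have "(A'\<^sup>2 + int d * B'\<^sup>2) mod 4 = 0" by presburger
    then have dvd4: "(A'\<^sup>2 mod 4 + (int d mod 4) * (B'\<^sup>2 mod 4)) mod 4 = 0"
      by (metis mod_add_left_eq mod_add_right_eq mod_mult_eq)
    have a: "a = of_int A' / 2" and b: "b = of_int B' / 2" using AB by auto
    have "\<not> (4::nat) dvd d"
      using d(2) unfolding squarefree_def by (auto dest: spec[of _ 2])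
    then have dm: "d mod 4 = 1 \<or> d mod 4 = 2 \<or> d mod 4 = 3" by presburger
    have dmi: "int d mod 4 = int (d mod 4)" by (simp add: zmod_int)
    have sq: "x\<^sup>2 mod 4 = (if even x then 0 else 1)" for x :: int
    proof (cases "even x")
      case True then show ?thesis by (auto elim!: evenE simp: power_mult_distrib)
    next
      case False
      then obtain c where "x = 2 * c + 1" by (elim oddE)
      then have "x\<^sup>2 = 1 + 4 * (c\<^sup>2 + c)" by (simp add: power2_eq_square algebra_simps)
      then show ?thesis using False by presburger
    qed
    show ?thesis
    proof (cases "d mod 4 = 3")
      case True
      have "even (A' - B')"
        using dvd4 dmi True unfolding sq by (auto split: if_splits)
      then obtain c where c: "A' = B' + 2 * c" by (metis evenE diff_add_cancel add.commute)
      have "u = of_int c + of_int B' * order_gen d"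
        unfolding ab a b using True c by (simp add: order_gen_def of_rat_divide of_rat_add of_rat_mult field_simps)
      then show ?thesis using R_I by metis
    next
      case False
      have "even A' \<and> even B'"
        using dvd4 False dmi dm unfolding sq by (auto split: if_splits)
      then obtain c e where "A' = 2 * c" "B' = 2 * e" by (auto elim!: evenE)
      then have "u = of_int c + of_int e * order_gen d"
        unfolding ab a b using False by (simp add: order_gen_def of_rat_divide)
      then show ?thesis using R_I by metis
    qed
  qed
qed

section \<open>Siegel's lemma\<close>

context quadratic_order
begin

section \<open>Counting points of the order in discs\<close>

definition R_disc :: "real \<Rightarrow> complex set" where
  "R_disc X = {p \<in> R. cmod p \<le> X}"

lemma finite_R_disc: "finite (R_disc X)"
proof -
  define N where "N = \<lceil>X / h + X + X / h * cmod \<omega>\<rceil>"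
  have "R_disc X \<subseteq> (\<lambda>(a, b). of_int a + of_int b * \<omega>) ` ({-N..N} \<times> {-N..N})"
  proof
    fix p assume "p \<in> R_disc X"
    then have "p \<in> R" and X: "cmod p \<le> X" by (auto simp: R_disc_def)
    then obtain a b where p: "p = of_int a + of_int b * \<omega>" by (auto elim: R_E)
    have X0: "X \<ge> 0" using X norm_ge_zero[of p] by linarith
    have "\<bar>of_int b * h\<bar> \<le> X" using abs_Im_le_cmod[of p] X unfolding p by simp
    then have b: "\<bar>of_int b\<bar> \<le> X / h"
      using Im_omega_pos by (simp add: field_simps abs_mult)
    have "cmod (of_int a) \<le> cmod p + cmod (of_int b * \<omega>)"
      unfolding p by (metis add_diff_cancel_right' norm_triangle_ineq4)
    also have "\<dots> \<le> X + X / h * cmod \<omega>"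
      using X mult_right_mono[OF b norm_ge_zero[of \<omega>]] by (simp add: norm_mult)
    finally have a: "\<bar>of_int a\<bar> \<le> X + X / h * cmod \<omega>" by simp
    have nn: "X / h * cmod \<omega> \<ge> 0" "X / h \<ge> 0" using X0 Im_omega_pos by simp_all
    have "\<bar>a\<bar> \<le> N" "\<bar>b\<bar> \<le> N"
      using a b nn X0 unfolding N_def by linarith+
    then show "p \<in> (\<lambda>(a, b). of_int a + of_int b * \<omega>) ` ({-N..N} \<times> {-N..N})"
      unfolding p by (auto intro!: image_eqI[of _ _ "(a, b)"])
  qed
  then show ?thesis by (rule finite_subset) auto
qed

lemma R_small_eq_0:
  assumes "p \<in> R" "\<bar>Re p\<bar> < 1" "\<bar>Im p\<bar> < h" shows "p = 0"
proof -
  obtain k :: int where k: "Im p = of_int k * h" using Im_R assms(1) by blast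
  then have "\<bar>of_int k\<bar> * h < 1 * h" using assms(3) Im_omega_pos by (simp add: abs_mult)
  then have "\<bar>of_int k\<bar> < (1::real)" using Im_omega_pos mult_less_cancel_right_pos by blast
  then have "k = 0" by simp
  then obtain j where "p = of_int j" using k assms(1) by (auto elim: Im_0_R)
  then show ?thesis using assms(2) by simp
qed

text \<open>The upright rectangle with sides 1 and h is a fundamental cell even when
  \<open>\<omega>\<close> is not purely imaginary: the order consists of horizontal rows at distance
  h, each with spacing 1.\<close>

lemma measure_tile: "measure lborel (cbox p (p + Complex 1 h)) = h" "measure lborel (box p (p + Complex 1 h)) = h"
proof -
  have "measure lborel (cbox p (p + Complex 1 h)) = (\<Prod>b\<in>Basis. (p + Complex 1 h) \<bullet> b - p \<bullet> b)"
    using Im_omega_pos by (intro content_cbox) (auto simp: Basis_complex_def algebra_simps)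
  also have "\<dots> = h" by (simp add: Basis_complex_def algebra_simps)
  finally show "measure lborel (cbox p (p + Complex 1 h)) = h" .
  show "measure lborel (box p (p + Complex 1 h)) = h"
    using Im_omega_pos by (simp add: measure_lborel_box_eq Basis_complex_def algebra_simps)
qed

lemma tile_bound:
  assumes "z \<in> cbox p (p + Complex 1 h)" shows "cmod (z - p) \<le> 1 + h"
proof -
  have "0 \<le> Re (z - p)" "Re (z - p) \<le> 1" "0 \<le> Im (z - p)" "Im (z - p) \<le> h"
    using assms by (auto simp: in_cbox_complex_iff)
  then show ?thesis using cmod_le[of "z - p"] by linarith
qed

lemma measure_cball_complex: "r \<ge> 0 \<Longrightarrow> measure lborel (cball (0::complex) r) = pi * r\<^sup>2"
  by (simp add: content_cball unit_ball_vol_2)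

text \<open>The open cells at the points counted are disjoint and lie in the disc of radius X + (1 +
  h), where 1 + h bounds the diameter of a cell.\<close>

lemma card_R_disc_upper:
  assumes "X \<ge> 0"
  shows "h * card (R_disc X) \<le> pi * (X + (1 + h))\<^sup>2"
proof -
  let ?B = "\<lambda>p. box p (p + Complex 1 h)"
  have disj: "pairwise (\<lambda>p q. disjnt (?B p) (?B q)) (R_disc X)"
  proof (rule pairwiseI)
    fix p q assume pq: "p \<in> R_disc X" "q \<in> R_disc X" "p \<noteq> q"
    show "disjnt (?B p) (?B q)"
    proof (rule ccontr)
      assume "\<not> disjnt (?B p) (?B q)"
      then obtain z where "z \<in> ?B p" "z \<in> ?B q" by (auto simp: disjnt_def)
      then have "\<bar>Re (p - q)\<bar> < 1" "\<bar>Im (p - q)\<bar> < h" by (auto simp: in_box_complex_iff)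
      moreover have "p - q \<in> R" using pq by (auto simp: R_disc_def)
      ultimately show False using R_small_eq_0 pq(3) by force
    qed
  qed
  have "h * card (R_disc X) = (\<Sum>p\<in>R_disc X. measure lborel (?B p))"
    by (simp add: measure_tile mult.commute)
  also have "\<dots> = measure lborel (\<Union>(?B ` R_disc X))"
    by (rule measure_UNION'[symmetric, OF finite_R_disc _ disj]) auto
  also have "\<dots> \<le> measure lborel (cball (0::complex) (X + (1 + h)))"
  proof (rule measure_mono_fmeasurable)
    show "\<Union>(?B ` R_disc X) \<subseteq> cball 0 (X + (1 + h))"
    proof
      fix z assume "z \<in> \<Union>(?B ` R_disc X)"
      then obtain p where p: "p \<in> R_disc X" "z \<in> ?B p" by blast
      then have "cmod (z - p) \<le> 1 + h" using tile_bound box_subset_cbox by blast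
      moreover have "cmod p \<le> X" using p by (simp add: R_disc_def)
      ultimately show "z \<in> cball 0 (X + (1 + h))"
        using norm_triangle_sub[of z p] by simp
    qed
    show "cball 0 (X + (1 + h)) \<in> fmeasurable lborel"
      by (intro fmeasurableI) (simp_all add: emeasure_bounded_finite flip: infinity_ennreal_def)
  qed (auto intro!: borel_open open_UN)
  also have "\<dots> = pi * (X + (1 + h))\<^sup>2"
    using assms Im_omega_pos by (intro measure_cball_complex) simp
  finally show ?thesis .
qed

text \<open>The closed cells at the points counted cover the disc of radius X - (1 + h).\<close>

lemma card_R_disc_lower:
  assumes "X \<ge> 1 + h"
  shows "pi * (X - (1 + h))\<^sup>2 \<le> h * card (R_disc X)"
proof -
  let ?B = "\<lambda>p. cbox p (p + Complex 1 h)"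
  have "pi * (X - (1 + h))\<^sup>2 = measure lborel (cball (0::complex) (X - (1 + h)))"
    using assms by (simp add: measure_cball_complex)
  also have "\<dots> \<le> measure lborel (\<Union>(?B ` R_disc X))"
  proof (rule measure_mono_fmeasurable)
    show "cball 0 (X - (1 + h)) \<subseteq> \<Union>(?B ` R_disc X)"
    proof
      fix z :: complex assume z: "z \<in> cball 0 (X - (1 + h))"
      \<comment> \<open>The row is chosen first, by the imaginary part; the position in the row then
        has to allow for its horizontal offset.\<close>
      define k where "k = \<lfloor>Im z / h\<rfloor>"
      define n where "n = \<lfloor>Re z - of_int k * Re \<omega>\<rfloor>"
      define p where "p = of_int n + of_int k * \<omega>"
      have "of_int k * h \<le> Im z" "Im z \<le> of_int k * h + h"
        using Im_omega_pos floor_divide_lower[of h "Im z"] floor_divide_upper[of h "Im z"]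
        unfolding k_def by (auto simp: algebra_simps)
      moreover have "of_int n \<le> Re z - of_int k * Re \<omega>" "Re z - of_int k * Re \<omega> \<le> of_int n + 1"
        unfolding n_def by linarith+
      ultimately have zp: "z \<in> ?B p" by (simp add: in_cbox_complex_iff p_def)
      have "cmod p \<le> X"
        using tile_bound[OF zp] z norm_triangle_sub[of p z] by (simp add: norm_minus_commute)
      then have "p \<in> R_disc X" using R_I[of n k] by (simp add: R_disc_def p_def)
      then show "z \<in> \<Union>(?B ` R_disc X)" using zp by blast
    qed
    show "\<Union>(?B ` R_disc X) \<in> fmeasurable lborel"
      using finite_R_disc by (intro fmeasurable.finite_UN) auto
  qed auto
  also have "\<dots> \<le> (\<Sum>p\<in>R_disc X. measure lborel (?B p))"
    by (rule measure_UNION_le[OF finite_R_disc]) auto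
  also have "\<dots> = h * card (R_disc X)"
    by (simp add: measure_tile mult.commute)
  finally show ?thesis .
qed

text \<open>The pigeonhole count compares areas of discs, so that up to a constant factor nothing is
  lost against the count for rational integers.\<close>

lemma siegel:
  fixes a :: "'b \<Rightarrow> nat \<Rightarrow> complex" and A :: "'b \<Rightarrow> real" and B :: real
  assumes I: "finite I" "card I < N"
    and aR: "\<And>i j. i \<in> I \<Longrightarrow> j < N \<Longrightarrow> a i j \<in> R"
    and aA: "\<And>i. i \<in> I \<Longrightarrow> (\<Sum>j<N. cmod (a i j)) \<le> A i"
    and A1: "\<And>i. i \<in> I \<Longrightarrow> A i \<ge> 1"
    and B: "B \<ge> 1" "(\<Prod>i\<in>I. A i) \<le> B ^ (N - card I)"
  obtains c where "\<And>j. j < N \<Longrightarrow> c j \<in> R" "\<exists>j<N. c j \<noteq> 0"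
    "\<And>i. i \<in> I \<Longrightarrow> (\<Sum>j<N. a i j * c j) = 0"
    "\<And>j. j < N \<Longrightarrow> cmod (c j) \<le> 10 * (1 + h) * N * B"
proof -
  define \<rho> where "\<rho> = 1 + h"
  \<comment> \<open>The domain uses the radius X, so that at least \<open>pi * Y\<^sup>2 / h\<close>
    points are available per coordinate. The factor N in Y keeps the boundary losses bounded when
    they are raised to the power 2 M, and B absorbs the product of the \<open>A i\<close>.\<close>
  define Y where "Y = 4 * \<rho> * N * B"
  define X where "X = Y + \<rho>"
  define M where "M = card I"
  define P where "P = (\<Prod>i\<in>I. A i)"
  have N: "real N \<ge> 1" "M < N" using I by (auto simp: M_def)
  have \<rho>: "\<rho> > 1" using Im_omega_pos by (simp add: \<rho>_def)
  have NB: "real N * B \<ge> 1" using mult_mono[of 1 "real N" 1 B] N B(1) by simp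
  have Y4: "Y \<ge> 4 * \<rho> * N" using B(1) N \<rho> by (simp add: Y_def)
  have Y0: "Y > 0" "Y \<ge> 4 * \<rho>" using \<rho> NB by (simp_all add: Y_def mult.assoc)
  have X0: "X > 0" "X \<ge> \<rho>" using Y0 \<rho> by (simp_all add: X_def)
  have P1: "P \<ge> 1" unfolding P_def using A1 by (rule prod_ge_1)
  define S where "S = PiE {..<N} (\<lambda>_. R_disc X)"
  define T where "T = PiE I (\<lambda>i. R_disc (A i * X))"
  define F where "F = (\<lambda>c. restrict (\<lambda>i. \<Sum>j<N. a i j * c j) I)"
  have finS: "finite S" "finite T" unfolding S_def T_def using I finite_R_disc
    by (auto intro: finite_PiE)
  have FS: "F ` S \<subseteq> T"
  proof (intro image_subsetI)
    fix c assume c: "c \<in> S"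
    show "F c \<in> T" unfolding T_def F_def
    proof (rule restrict_PiE_iff[THEN iffD2], intro ballI)
      fix i assume i: "i \<in> I"
      have cR: "c j \<in> R" "cmod (c j) \<le> X" if "j < N" for j
        using c that by (auto simp: S_def R_disc_def PiE_iff)
      have "cmod (\<Sum>j<N. a i j * c j) \<le> (\<Sum>j<N. cmod (a i j) * X)"
        by (intro sum_norm_le) (auto simp: norm_mult intro: mult_left_mono cR)
      also have "\<dots> \<le> A i * X"
        unfolding sum_distrib_right[symmetric] using aA[OF i] X0 by (intro mult_right_mono) auto
      finally show "(\<Sum>j<N. a i j * c j) \<in> R_disc (A i * X)"
        using aR[OF i] cR by (auto simp: R_disc_def)
    qed
  qed
  have "card T < card S"
  proof -
    have h0: "h > 0" by (rule Im_omega_pos)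
    have "real (card T) = (\<Prod>i\<in>I. real (card (R_disc (A i * X))))"
      unfolding T_def using I by (simp add: card_PiE)
    also have "\<dots> \<le> (\<Prod>i\<in>I. (A i)\<^sup>2 * (pi / h * (X + \<rho>)\<^sup>2))"
    proof (intro prod_mono conjI)
      fix i assume i: "i \<in> I"
      have "h * card (R_disc (A i * X)) \<le> pi * (A i * X + \<rho>)\<^sup>2"
        using card_R_disc_upper[of "A i * X"] A1[OF i] X0 by (simp add: \<rho>_def)
      also have "\<dots> \<le> pi * (A i * (X + \<rho>))\<^sup>2"
        using A1[OF i] X0 \<rho> by (intro mult_left_mono power_mono) (auto simp: algebra_simps)
      finally have "card (R_disc (A i * X)) \<le> pi * (A i * (X + \<rho>))\<^sup>2 / h"
        using h0 by (simp add: pos_le_divide_eq mult.commute)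
      then show "real (card (R_disc (A i * X))) \<le> (A i)\<^sup>2 * (pi / h * (X + \<rho>)\<^sup>2)"
        by (simp add: power_mult_distrib mult_ac)
    qed auto
    also have "\<dots> = P\<^sup>2 * (pi / h) ^ M * (X + \<rho>) ^ (2 * M)"
      by (simp only: prod.distrib prod_constant P_def M_def prod_power_distrib power_mult_distrib
          power_mult mult.assoc)
    \<comment> \<open>Since X + \<open>\<rho>\<close> = Y + 2 \<open>\<rho>\<close> and Y is at
      least 4 \<open>\<rho>\<close> N with M < N, all boundary effects together cost only a factor
      e.\<close>
    also have "\<dots> \<le> (B ^ (N - M))\<^sup>2 * (pi / h) ^ M * (exp 1 * Y ^ (2 * M))"
    proof (intro mult_mono power_mono)
      have "(X + \<rho>) ^ (2 * M) = (1 + 2 * \<rho> / Y) ^ (2 * M) * Y ^ (2 * M)"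
        using Y0 by (simp add: X_def field_simps flip: power_mult_distrib)
      also have "(1 + 2 * \<rho> / Y) ^ (2 * M) \<le> exp (2 * \<rho> / Y) ^ (2 * M)"
        using Y0 \<rho> by (intro power_mono exp_ge_add_one_self) auto
      also have "exp (2 * \<rho> / Y) ^ (2 * M) = exp (4 * \<rho> * M / Y)"
        by (simp flip: exp_of_nat_mult)
      also have "\<dots> \<le> exp 1"
      proof -
        have "4 * \<rho> * M \<le> 4 * \<rho> * N" using N \<rho> by simp
        then show ?thesis using Y4 Y0 by (simp add: field_simps)
      qed
      finally show "(X + \<rho>) ^ (2 * M) \<le> exp 1 * Y ^ (2 * M)" using Y0 by simp
    qed (use P1 B h0 X0 \<rho> in \<open>auto simp: P_def M_def\<close>)
    also have "\<dots> < (pi / h * Y\<^sup>2) ^ N"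
    proof -
      have "exp 1 * (B ^ (N - M))\<^sup>2 < (pi / h * Y\<^sup>2) ^ (N - M)"
      proof -
        have "exp 1 * B\<^sup>2 < pi / h * Y\<^sup>2"
        proof -
          \<comment> \<open>The factor \<open>\<rho>\<close> = 1 + h in Y compensates the sparsity
            of the order: (1 + h)^2 / h exceeds e / 3 for every h.\<close>
          have "exp 1 * h < 3 * (1 + h)\<^sup>2"
          proof -
            have "exp 1 * h \<le> 3 * h" using exp_le h0 by (intro mult_right_mono) auto
            moreover have "3 * (1 + h)\<^sup>2 = 3 + 6 * h + 3 * h\<^sup>2"
              by (simp add: power2_eq_square algebra_simps)
            ultimately show ?thesis using h0 zero_le_power2[of h] by linarith
          qed
          also have "\<dots> \<le> pi * \<rho>\<^sup>2" using pi_gt3 by (simp add: \<rho>_def mult_right_mono)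
          also have "\<dots> \<le> pi * (4 * \<rho> * N)\<^sup>2"
            using N \<rho> by (intro mult_left_mono power_mono) auto
          finally have "exp 1 * h * B\<^sup>2 < pi * (4 * \<rho> * N)\<^sup>2 * B\<^sup>2" using B by simp
          then show ?thesis using h0 by (simp add: field_simps Y_def power_mult_distrib)
        qed
        then have "(exp 1 * B\<^sup>2) ^ (N - M) < (pi / h * Y\<^sup>2) ^ (N - M)"
          using N by (intro power_strict_mono) auto
        moreover have "exp 1 * (B ^ (N - M))\<^sup>2 \<le> (exp 1 * B\<^sup>2) ^ (N - M)"
          using N self_le_power[of "exp (1::real)" "N - M"] B
          by (simp add: power_mult_distrib power_even_eq[symmetric] flip: power_mult)
            (simp add: mult.commute)
        ultimately show ?thesis by linarith
      qed
      then have "exp 1 * (B ^ (N - M))\<^sup>2 * (pi / h * Y\<^sup>2) ^ M < (pi / h * Y\<^sup>2) ^ (N - M) * (pi / h * Y\<^sup>2) ^ M"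
        using h0 Y0 by (intro mult_strict_right_mono) auto
      also have "\<dots> = (pi / h * Y\<^sup>2) ^ N" using N by (simp flip: power_add)
      finally show ?thesis
        unfolding power_mult[of Y 2 M] by (simp only: power_mult_distrib[of "pi / h"] mult_ac)
    qed
    also have "\<dots> \<le> real (card (R_disc X)) ^ N"
    proof (intro power_mono)
      have "pi * Y\<^sup>2 \<le> h * card (R_disc X)"
        using card_R_disc_lower[of X] X0 by (simp add: \<rho>_def X_def)
      then show "pi / h * Y\<^sup>2 \<le> card (R_disc X)" using h0 by (simp add: field_simps)
    qed (use h0 in auto)
    also have "\<dots> = real (card S)" unfolding S_def by (simp add: card_PiE)
    finally show ?thesis by simp
  qed
  then have "\<not> inj_on F S" using FS finS by (metis card_inj_on_le not_less)
  then obtain c d where cd: "c \<in> S" "d \<in> S" "c \<noteq> d" "F c = F d"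
    by (auto simp: inj_on_def)
  \<comment> \<open>A difference of two vectors from the pigeonhole has entries up to 2 X = 8
    \<open>\<rho>\<close> N B + 2 \<open>\<rho>\<close>, and N B is at least 1.\<close>
  have XB: "2 * X \<le> 10 * (1 + h) * N * B"
    using mult_left_mono[OF NB, of "\<rho>"] \<rho> by (simp add: X_def Y_def \<rho>_def algebra_simps)
  show ?thesis
  proof (rule that[of "\<lambda>j. c j - d j"])
    fix j assume j: "j < N"
    have "c j \<in> R_disc X" "d j \<in> R_disc X" using cd j by (auto simp: S_def PiE_iff)
    then show "c j - d j \<in> R" "cmod (c j - d j) \<le> 10 * (1 + h) * N * B"
      using XB norm_triangle_ineq4[of "c j" "d j"] by (auto simp: R_disc_def)
  next
    show "\<exists>j<N. c j - d j \<noteq> 0"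
      using cd by (auto simp: S_def PiE_def extensional_def) (metis ext)
  next
    fix i assume "i \<in> I"
    then show "(\<Sum>j<N. a i j * (c j - d j)) = 0"
      using fun_cong[OF cd(4), of i] by (simp add: F_def sum_subtractf algebra_simps)
  qed
qed

end

section \<open>Determinants of polynomial matrices\<close>

lemma fps_X_power_dvd_iff:
  "fps_X ^ n dvd (f :: 'a::comm_ring_1 fps) \<longleftrightarrow> (\<forall>i<n. fps_nth f i = 0)"
proof
  assume "fps_X ^ n dvd f"
  then show "\<forall>i<n. fps_nth f i = 0" by (auto simp: fps_X_power_mult_nth)
next
  assume "\<forall>i<n. fps_nth f i = 0"
  then have "f = fps_X ^ n * fps_shift n f"
    by (intro fps_ext) (auto simp: fps_X_power_mult_nth)
  then show "fps_X ^ n dvd f" by (rule dvdI)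
qed

text \<open>Every product in the Leibniz formula takes exactly one entry from each column.\<close>

lemma det_column_dvd:
  fixes A :: "'a::comm_ring_1 mat"
  assumes A: "A \<in> carrier_mat n n"
    and d: "\<And>i j. i < n \<Longrightarrow> j < n \<Longrightarrow> d j dvd A $$ (i, j)"
  shows "(\<Prod>j<n. d j) dvd det A"
  unfolding det_def'[OF A]
proof (intro dvd_sum dvd_mult)
  fix p assume "p \<in> {p. p permutes {0..<n}}"
  then have p: "p permutes {0..<n}" by simp
  have "(\<Prod>j<n. d j) = (\<Prod>i = 0..<n. d (p i))"
    using prod.permute[OF p, of d] by (simp add: lessThan_atLeast0 comp_def)
  also have "\<dots> dvd (\<Prod>i = 0..<n. A $$ (i, p i))"
    using permutes_in_image[OF p] by (intro prod_dvd_prod d) auto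
  finally show "(\<Prod>j<n. d j) dvd (\<Prod>i = 0..<n. A $$ (i, p i))" .
qed

text \<open>Column operations are packaged as multiplication on the right by a triangular
  matrix.\<close>

lemma det_mult_upper_triangular:
  fixes A C :: "'a::comm_ring_1 mat"
  assumes "A \<in> carrier_mat n n" "C \<in> carrier_mat n n" "upper_triangular C"
  shows "det (A * C) = det A * (\<Prod>j<n. C $$ (j, j))"
  using assms det_mult[of A n C] det_upper_triangular[of C n]
  by (simp add: prod_list_diag_prod lessThan_atLeast0)

lemma coeff_mult_degree_bound:
  assumes "degree p \<le> a" "degree q \<le> b"
  shows "coeff (p * q) (a + b) = coeff p a * coeff q b"
proof -
  have "coeff (p * q) (a + b) = (\<Sum>i\<le>a + b. coeff p i * coeff q (a + b - i))"
    by (simp add: coeff_mult)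
  also have "\<dots> = (\<Sum>i\<in>{a}. coeff p i * coeff q (a + b - i))"
  proof (intro sum.mono_neutral_right ballI)
    fix i assume "i \<in> {..a + b} - {a}"
    then have "i < a \<or> i > a" by auto
    then show "coeff p i * coeff q (a + b - i) = 0"
      using assms by (auto simp: coeff_eq_0)
  qed auto
  finally show ?thesis by simp
qed

lemma degree_prod_le_sum:
  fixes f :: "'b \<Rightarrow> 'a::comm_semiring_1 poly"
  assumes "finite I" "\<And>i. i \<in> I \<Longrightarrow> degree (f i) \<le> d i"
  shows "degree (\<Prod>i\<in>I. f i) \<le> (\<Sum>i\<in>I. d i)"
  using assms by (induction I) (auto intro: order.trans[OF degree_mult_le] add_mono)

lemma coeff_prod_degree_bound:
  fixes f :: "'b \<Rightarrow> 'a::comm_semiring_1 poly"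
  assumes "finite I" "\<And>i. i \<in> I \<Longrightarrow> degree (f i) \<le> d i"
  shows "coeff (\<Prod>i\<in>I. f i) (\<Sum>i\<in>I. d i) = (\<Prod>i\<in>I. coeff (f i) (d i))"
  using assms
proof (induction I)
  case (insert x I)
  then show ?case
    using coeff_mult_degree_bound[of "f x" "d x" "prod f I" "sum d I"] degree_prod_le_sum[of I f d]
    by simp
qed simp

text \<open>Each Leibniz product takes one factor from every column, so the sum of the column
  degrees bounds its degree and its coefficient there is the product of the top
  coefficients.\<close>

lemma coeff_det_degree_bound:
  fixes A :: "'a::comm_ring_1 poly mat"
  assumes A: "A \<in> carrier_mat n n"
    and d: "\<And>i j. i < n \<Longrightarrow> j < n \<Longrightarrow> degree (A $$ (i, j)) \<le> d j"
  shows "coeff (det A) (\<Sum>j<n. d j) = det (mat n n (\<lambda>(i, j). coeff (A $$ (i, j)) (d j)))"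
    (is "_ = det ?B")
proof -
  have B: "?B \<in> carrier_mat n n" by simp
  have "coeff (signof p * (\<Prod>i = 0..<n. A $$ (i, p i))) (\<Sum>j<n. d j)
      = signof p * (\<Prod>i = 0..<n. ?B $$ (i, p i))" if p: "p permutes {0..<n}" for p
  proof -
    have "(\<Sum>j<n. d j) = (\<Sum>i = 0..<n. d (p i))"
      using sum.permute[OF p, of d] by (simp add: lessThan_atLeast0 comp_def)
    then have "coeff (\<Prod>i = 0..<n. A $$ (i, p i)) (\<Sum>j<n. d j)
        = (\<Prod>i = 0..<n. coeff (A $$ (i, p i)) (d (p i)))"
      using permutes_in_image[OF p] d
        coeff_prod_degree_bound[of "{0..<n}" "\<lambda>i. A $$ (i, p i)" "\<lambda>i. d (p i)"] by simp
    also have "\<dots> = (\<Prod>i = 0..<n. ?B $$ (i, p i))"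
      using permutes_in_image[OF p] by (intro prod.cong) auto
    finally show ?thesis by (cases "sign p = 1") (auto simp: sign_def)
  qed
  then show ?thesis
    unfolding det_def'[OF A] det_def'[OF B] coeff_sum by (intro sum.cong) auto
qed

text \<open>A kernel vector of the transpose would be the coefficient list of a nonzero polynomial
  of degree less than n with the n distinct roots \<open>b j\<close>.\<close>

lemma det_Vandermonde_nz:
  fixes b w :: "nat \<Rightarrow> 'a::field"
  assumes inj: "inj_on b {..<n}" and w: "\<And>j. j < n \<Longrightarrow> w j \<noteq> 0"
  shows "det (mat n n (\<lambda>(k, j). b j ^ k * w j)) \<noteq> 0" (is "det ?V \<noteq> 0")
proof
  assume "det ?V = 0"
  then have "det (transpose_mat ?V) = 0" by (simp add: det_transpose[of _ n])
  then obtain v where v: "v \<in> carrier_vec n" "v \<noteq> 0\<^sub>v n" "transpose_mat ?V *\<^sub>v v = 0\<^sub>v n"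
    using det_0_iff_vec_prod_zero[of "transpose_mat ?V" n] by auto
  define p where "p = (\<Sum>k<n. monom (vec_index v k) k)"
  have coeff_p: "coeff p k = (if k < n then vec_index v k else 0)" for k
    by (simp add: p_def coeff_sum if_distrib sum.delta' cong: if_cong)
  have "poly p (b j) = 0" if j: "j < n" for j
  proof -
    have "0 = vec_index (transpose_mat ?V *\<^sub>v v) j" using v j by simp
    also have "\<dots> = (\<Sum>k = 0..<n. b j ^ k * w j * vec_index v k)"
      using j v(1) by (simp add: scalar_prod_def)
    also have "\<dots> = w j * poly p (b j)"
      by (simp add: p_def poly_sum poly_monom sum_distrib_left lessThan_atLeast0 mult_ac)
    finally show ?thesis using w[OF j] by simp
  qed
  then have "b ` {..<n} \<subseteq> {x. poly p x = 0}" by auto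
  moreover have "p \<noteq> 0"
  proof
    assume "p = 0"
    then have "vec_index v k = 0" if "k < n" for k using coeff_p[of k] that by simp
    then have "v = 0\<^sub>v n" using v(1) by (intro eq_vecI) auto
    then show False using v by simp
  qed
  ultimately have "card (b ` {..<n}) \<le> degree p"
    using card_mono[OF poly_roots_finite] card_poly_roots_bound order.trans by metis
  moreover have "card (b ` {..<n}) = n" using inj by (simp add: card_image)
  moreover have "degree p < n"
    using coeff_p[of "degree p"] \<open>p \<noteq> 0\<close> by (auto split: if_splits)
  ultimately show False by simp
qed

section \<open>Nonvanishing of derived approximations\<close>

text \<open>\<open>exp_op a\<close> acts on \<open>p\<close> as differentiation acts on \<open>p(t) exp(- a t)\<close>.\<close>

definition exp_op :: "complex \<Rightarrow> complex poly \<Rightarrow> complex poly" where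
  "exp_op a p = pderiv p - smult a p"

lemma coeff_exp_op: "coeff (exp_op a p) n = of_nat (Suc n) * coeff p (Suc n) - a * coeff p n"
  by (simp add: exp_op_def coeff_pderiv)

lemma degree_exp_op:
  "degree p \<le> d \<Longrightarrow> degree ((exp_op a ^^ k) p) \<le> d"
proof (induction k)
  case (Suc k)
  then show ?case by (intro degree_le) (auto simp: coeff_exp_op coeff_eq_0)
qed simp

text \<open>Differentiation contributes nothing at the degree bound, so each application multiplies
  this coefficient by - a. The powers of - \<open>\<alpha> j\<close> form the Vandermonde
  matrix.\<close>

lemma coeff_exp_op_power:
  "degree p \<le> d \<Longrightarrow> coeff ((exp_op a ^^ k) p) d = (- a) ^ k * coeff p d"
proof (induction k)
  case (Suc k)
  have "coeff ((exp_op a ^^ k) p) (Suc d) = 0"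
    using degree_exp_op[OF Suc.prems] by (intro coeff_eq_0) (simp add: le_imp_less_Suc)
  then show ?case using Suc by (simp add: coeff_exp_op)
qed simp

definition fps_exp_op :: "complex \<Rightarrow> complex fps \<Rightarrow> complex fps" where
  "fps_exp_op a f = fps_deriv f - fps_const a * f"

lemma fps_of_poly_exp_op: "fps_of_poly (exp_op a p) = fps_exp_op a (fps_of_poly p)"
  by (simp add: exp_op_def fps_exp_op_def fps_of_poly_diff fps_of_poly_pderiv fps_of_poly_smult)

lemma fps_of_poly_exp_op_power:
  "fps_of_poly ((exp_op a ^^ k) p) = (fps_exp_op a ^^ k) (fps_of_poly p)"
  by (induction k) (simp_all add: fps_of_poly_exp_op)

lemma fps_exp_op_power_diff:
  "(fps_exp_op a ^^ k) (f - g) = (fps_exp_op a ^^ k) f - (fps_exp_op a ^^ k) g"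
proof -
  have "fps_exp_op a (f - g) = fps_exp_op a f - fps_exp_op a g" for f g
    by (simp add: fps_exp_op_def algebra_simps)
  then show ?thesis by (induction k) simp_all
qed

text \<open>By the product rule the derivative of the exponential cancels. Thus for each j the k-th
  derived approximation has the same denominator, the k-th derivative of \<open>A 0\<close>.\<close>

lemma fps_exp_op_power_exp:
  "(fps_exp_op a ^^ k) (fps_exp a * f) = fps_exp a * (fps_deriv ^^ k) f"
proof -
  have "fps_exp_op a (fps_exp a * f) = fps_exp a * fps_deriv f" for f
    by (simp add: fps_exp_op_def algebra_simps)
  then show ?thesis by (induction k) simp_all
qed

lemma fps_exp_op_0: "fps_exp_op 0 = fps_deriv"
  by (simp add: fps_exp_op_def fun_eq_iff)

text \<open>A coefficient of the image depends only on those of the same and the next index, so a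
  gap shrinks by one at its upper end per application and keeps its lower end.\<close>

lemma fps_exp_op_power_nth_eq_0:
  assumes "\<And>i. a \<le> i \<Longrightarrow> i < n \<Longrightarrow> fps_nth f i = 0" "a \<le> i" "i + k < n"
  shows "fps_nth ((fps_exp_op b ^^ k) f) i = 0"
  using assms(2,3)
proof (induction k arbitrary: i)
  case (Suc k)
  then show ?case using Suc.IH[of i] Suc.IH[of "Suc i"] by (simp add: fps_exp_op_def)
qed (use assms in simp)

text \<open>The determinant of the vectors obtained from \<open>A\<close> by applying the first \<open>m + 1\<close> powers of the
  operators is, up to an exponential factor, a Wronskian. Its leading coefficient is a Vandermonde
  determinant, so it does not vanish identically, and column operations with exponential series show
  that it vanishes to high order at 0. If all the linear forms vanished at 1, it would vanish there to
  an order exceeding its degree minus the order at 0.\<close>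

lemma exp_approx_nonvanishing:
  fixes A :: "nat \<Rightarrow> complex poly" and \<alpha> \<beta> :: "nat \<Rightarrow> complex" and m L K :: nat
  assumes inj: "inj_on \<alpha> {0..m}" and \<alpha>0: "\<alpha> 0 = 0"
    and A: "\<And>j. j \<le> m \<Longrightarrow> A j \<noteq> 0" "\<And>j. j \<le> m \<Longrightarrow> degree (A j) \<le> L"
    and van: "\<And>j i. j \<in> {1..m} \<Longrightarrow> i < n j \<Longrightarrow>
        fps_nth (fps_of_poly (A j) - fps_exp (\<alpha> j) * fps_of_poly (A 0)) i = 0"
    and \<beta>: "\<exists>i\<le>m. \<beta> i \<noteq> 0"
    and K: "K \<ge> m" "K + 1 + (\<Sum>j=1..m. n j - m) > (m + 1) * L + m"
  shows "\<exists>k\<le>K. (\<Sum>j\<le>m. \<beta> j * poly ((exp_op (\<alpha> j) ^^ k) (A j)) 1) \<noteq> 0"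
proof (rule ccontr)
  assume "\<not> ?thesis"
  then have zero: "(\<Sum>j\<le>m. \<beta> j * poly ((exp_op (\<alpha> j) ^^ k) (A j)) 1) = 0" if "k \<le> K" for k
    using that by blast
  define P where "P k j = (exp_op (\<alpha> j) ^^ k) (A j)" for k j
  define M where "M = mat (Suc m) (Suc m) (\<lambda>(k, j). P k j)"
  define W where "W = det M"
  have M: "M \<in> carrier_mat (Suc m) (Suc m)" by (simp add: M_def)
  have Mkj: "M $$ (k, j) = P k j" if "k \<le> m" "j \<le> m" for k j using that by (simp add: M_def)

  have degW: "degree W \<le> L * Suc m"
    unfolding W_def using M A(2)
    by (intro degree_det_le) (auto simp: M_def P_def intro: degree_exp_op)

  have "coeff W (\<Sum>j<Suc m. degree (A j)) \<noteq> 0"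
  proof -
    have "coeff W (\<Sum>j<Suc m. degree (A j))
        = det (mat (Suc m) (Suc m) (\<lambda>(k, j). coeff (M $$ (k, j)) (degree (A j))))"
      unfolding W_def
      by (rule coeff_det_degree_bound[OF M]) (simp add: Mkj P_def degree_exp_op)
    also have "mat (Suc m) (Suc m) (\<lambda>(k, j). coeff (M $$ (k, j)) (degree (A j)))
        = mat (Suc m) (Suc m) (\<lambda>(k, j). (- \<alpha> j) ^ k * lead_coeff (A j))"
      by (intro eq_matI) (auto simp: Mkj P_def coeff_exp_op_power)
    also have "det \<dots> \<noteq> 0"
    proof (rule det_Vandermonde_nz)
      show "inj_on (\<lambda>j. - \<alpha> j) {..<Suc m}"
        using inj by (auto simp: inj_on_def)
    qed (use A(1) in auto)
    finally show ?thesis .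
  qed
  then have W0: "W \<noteq> 0" by auto

  \<comment> \<open>Row k has been differentiated k times, with k at most m, so column j still
    vanishes to order \<open>n j - m\<close> in all rows.\<close>
  define N0 where "N0 = (\<Sum>j=1..m. n j - m)"
  have dvd0: "monom 1 N0 dvd W"
  proof -
    interpret comm_ring_hom "fps_of_poly :: complex poly \<Rightarrow> complex fps"
      by unfold_locales (simp_all add: fps_of_poly_simps)
    define F where "F = map_mat fps_of_poly M"
    \<comment> \<open>Multiplying by C subtracts exp(\<open>\<alpha> j\<close> t) times column 0
      from every other column j, which turns its entries into derived remainders.\<close>
    define C where "C = mat (Suc m) (Suc m) (\<lambda>(i, j). if i = j then 1
        else if i = 0 then - fps_exp (\<alpha> j) else (0 :: complex fps))"
    have F: "F \<in> carrier_mat (Suc m) (Suc m)" using M by (simp add: F_def)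
    have C: "C \<in> carrier_mat (Suc m) (Suc m)" "upper_triangular C"
      by (auto simp: C_def upper_triangular_def)
    have "(\<Prod>j<Suc m. fps_X ^ (if j = 0 then 0 else n j - m)) dvd det (F * C)"
    proof (rule det_column_dvd)
      fix k j assume kj: "k < Suc m" "j < Suc m"
      show "fps_X ^ (if j = 0 then 0 else n j - m) dvd (F * C) $$ (k, j)"
      proof (cases "j = 0")
        case False
        have "(F * C) $$ (k, j) = (\<Sum>i = 0..<Suc m. F $$ (k, i) * C $$ (i, j))"
          using F C kj by (simp add: scalar_prod_def)
        also have "\<dots> = (\<Sum>i\<in>{0, j}. F $$ (k, i) * C $$ (i, j))"
          using kj by (intro sum.mono_neutral_right) (auto simp: C_def)
        also have "\<dots> = fps_of_poly (P k j) - fps_exp (\<alpha> j) * fps_of_poly (P k 0)"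
          using False kj by (simp add: C_def F_def M_def)
        also have "\<dots> = (fps_exp_op (\<alpha> j) ^^ k) (fps_of_poly (A j) - fps_exp (\<alpha> j) * fps_of_poly (A 0))"
          by (simp add: P_def fps_of_poly_exp_op_power fps_exp_op_power_diff fps_exp_op_power_exp \<alpha>0 fps_exp_op_0)
        finally show ?thesis
          using kj False
          by (auto simp: fps_X_power_dvd_iff intro!: fps_exp_op_power_nth_eq_0[of 0 "n j"] van)
      qed simp
    qed (use F C in auto)
    also have "(\<Prod>j<Suc m. fps_X ^ (if j = 0 then 0 else n j - m)) = fps_X ^ N0"
    proof -
      have "N0 = (\<Sum>j<Suc m. if j = 0 then 0 else n j - m)"
        unfolding N0_def by (intro sum.mono_neutral_cong_left) auto
      then show ?thesis by (simp only: power_sum)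
    qed
    also have "det (F * C) = det F"
      using det_mult_upper_triangular[OF F C] by (simp add: C_def)
    also have "det F = fps_of_poly W"
      unfolding F_def W_def by (rule hom_det)
    finally show ?thesis by (simp add: fps_X_power_dvd_iff monom_1_dvd_iff')
  qed

  \<comment> \<open>The values for k = 0, ..., K vanish, and the last row uses up m of these K + 1
    conditions.\<close>
  define N1 where "N1 = K + 1 - m"
  have dvd1: "[:-1, 1:] ^ N1 dvd W"
  proof -
    \<comment> \<open>Expansion in powers of t - 1.\<close>
    define \<phi> where "\<phi> p = fps_of_poly (pcompose p [:1, 1:])" for p :: "complex poly"
    interpret comm_ring_hom \<phi>
      by unfold_locales (simp_all add: \<phi>_def fps_of_poly_add fps_of_poly_mult pcompose_add pcompose_mult pcompose_1)
    \<comment> \<open>Column \<open>i0\<close> is replaced by the linear form. Taking the last index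
      with a nonzero coefficient makes C upper triangular, and its only diagonal entry other than 1
      is a unit power series.\<close>
    define i0 where "i0 = Max {i. i \<le> m \<and> \<beta> i \<noteq> 0}"
    have fin: "finite {i. i \<le> m \<and> \<beta> i \<noteq> 0}" by simp
    have i0: "i0 \<le> m" "\<beta> i0 \<noteq> 0"
      using Max_in[OF fin] \<beta> by (auto simp: i0_def)
    have i0_max: "\<beta> i = 0" if "i \<le> m" "i > i0" for i
      using Max_ge[OF fin, of i] that unfolding i0_def by fastforce
    define F where "F = map_mat \<phi> M"
    define C where "C = mat (Suc m) (Suc m) (\<lambda>(i, j). if j = i0 then
        fps_const (\<beta> i) * fps_exp (- \<alpha> i) else if i = j then 1 else (0 :: complex fps))"
    have F: "F \<in> carrier_mat (Suc m) (Suc m)" using M by (simp add: F_def)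
    have C: "C \<in> carrier_mat (Suc m) (Suc m)" "upper_triangular C"
      by (auto simp: C_def upper_triangular_def i0_max)
    \<comment> \<open>Up to a shift, g k is the sum of \<open>\<beta> j\<close> exp(-
      \<open>\<alpha> j\<close> t) times the k-th derived polynomials. Its derivative is g (k + 1),
      so the vanishing values become vanishing Taylor coefficients of a single series.\<close>
    define g where "g k = (\<Sum>j\<le>m. fps_const (\<beta> j) * fps_exp (- \<alpha> j) * \<phi> (P k j))" for k
    have g0: "fps_nth (g k) 0 = 0" if "k \<le> K" for k
    proof -
      have "fps_nth (g k) 0 = (\<Sum>j\<le>m. \<beta> j * poly (P k j) 1)"
        by (simp add: g_def fps_sum_nth \<phi>_def pcompose_coeff_0)
      then show ?thesis using zero[OF that] by (simp add: P_def)
    qed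
    have g_deriv: "fps_deriv (g k) = g (Suc k)" for k
    proof -
      have "fps_deriv (\<phi> p) = \<phi> (pderiv p)" for p
        by (simp add: \<phi>_def pderiv_pcompose pderiv_pCons flip: fps_of_poly_pderiv)
      moreover have "\<phi> (smult a p) = fps_const a * \<phi> p" for a p
        by (simp add: \<phi>_def pcompose_smult fps_of_poly_smult)
      ultimately show ?thesis unfolding g_def fps_deriv_sum
        by (intro sum.cong) (simp_all add: P_def exp_op_def hom_minus algebra_simps
              fps_const_neg[symmetric] del: fps_const_neg)
    qed
    have g_nth: "fps_nth (g k) r = 0" if "k + r \<le> K" for k r
      using that
    proof (induction r arbitrary: k)
      case (Suc r)
      have "of_nat (Suc r) * fps_nth (g k) (Suc r) = fps_nth (fps_deriv (g k)) r" by simp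
      also have "\<dots> = 0" using Suc by (simp add: g_deriv)
      finally show ?case by (simp del: of_nat_Suc)
    qed (use g0 in simp)
    have "(\<Prod>j<Suc m. fps_X ^ (if j = i0 then N1 else 0)) dvd det (F * C)"
    proof (rule det_column_dvd)
      fix k j assume kj: "k < Suc m" "j < Suc m"
      show "fps_X ^ (if j = i0 then N1 else 0) dvd (F * C) $$ (k, j)"
      proof (cases "j = i0")
        case True
        have "(F * C) $$ (k, j) = (\<Sum>i = 0..<Suc m. F $$ (k, i) * C $$ (i, j))"
          using F C kj by (simp add: scalar_prod_def)
        also have "\<dots> = g k"
          unfolding g_def using kj True
          by (intro sum.cong) (auto simp: C_def F_def M_def)
        finally show ?thesis
          using kj K True by (auto simp: fps_X_power_dvd_iff N1_def intro!: g_nth)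
      qed simp
    qed (use F C in auto)
    also have "(\<Prod>j<Suc m. fps_X ^ (if j = i0 then N1 else 0)) = fps_X ^ N1"
      using i0 by (simp add: if_distrib prod.delta cong: if_cong)
    also have "det (F * C) = \<phi> W * (\<Prod>j<Suc m. C $$ (j, j))"
      using det_mult_upper_triangular[OF F C] by (simp add: F_def W_def hom_det)
    also have "(\<Prod>j<Suc m. C $$ (j, j)) = (\<Prod>j<Suc m. if j = i0 then fps_const (\<beta> j) * fps_exp (- \<alpha> j) else 1)"
      by (intro prod.cong) (auto simp: C_def)
    also have "\<dots> = fps_const (\<beta> i0) * fps_exp (- \<alpha> i0)"
      using i0 by (simp add: prod.delta)
    finally have "fps_X ^ N1 dvd \<phi> W * (fps_const (\<beta> i0) * fps_exp (- \<alpha> i0))" .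
    moreover have "(fps_const (\<beta> i0) * fps_exp (- \<alpha> i0)) dvd 1" using i0 by simp
    ultimately have "fps_X ^ N1 dvd \<phi> W" by (simp only: dvd_mult_unit_iff)
    then have "monom 1 N1 dvd pcompose W [:1, 1:]"
      by (simp add: fps_X_power_dvd_iff monom_1_dvd_iff' \<phi>_def)
    then obtain Q where "pcompose W [:1, 1:] = [:0, 1:] ^ N1 * Q"
      by (auto elim!: dvdE simp: monom_altdef)
    then have "pcompose (pcompose W [:1, 1:]) [:-1, 1:] = pcompose ([:0, 1:] ^ N1 * Q) [:-1, 1:]" by simp
    moreover have "pcompose (pcompose W [:1, 1:]) [:-1, 1:] = W"
      by (simp add: pcompose_pCons flip: pcompose_assoc)
    moreover have "pcompose ([:0, 1:] ^ n) [:-1, 1:] = [:-1, 1 :: complex:] ^ n" for n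
      by (induction n) (simp_all add: pcompose_mult pcompose_1 pcompose_pCons)
    ultimately have "W = [:-1, 1:] ^ N1 * pcompose Q [:-1, 1:]"
      by (simp add: pcompose_mult)
    then show ?thesis by (rule dvdI)
  qed

  \<comment> \<open>The zeros at 0 and at 1 are counted separately: N0 + N1 is at most the degree of
    W, hence at most (m + 1) L, against the assumption on K.\<close>
  obtain V where V: "W = monom 1 N0 * V" using dvd0 by (elim dvdE)
  have "V \<noteq> 0" using V W0 by auto
  have "N1 \<le> order 1 W" using dvd1 W0 by (simp add: order_divides)
  also have "order 1 W = order 1 (monom (1::complex) N0) + order 1 V"
    using W0 unfolding V by (rule order_mult)
  also have "order 1 (monom (1::complex) N0) = 0" by (rule order_0I) (simp add: poly_monom)
  finally have "N1 \<le> degree V" using order_degree[OF \<open>V \<noteq> 0\<close>, of 1] by simp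
  then have "N0 + N1 \<le> degree W"
    unfolding V using \<open>V \<noteq> 0\<close> by (simp add: degree_mult_eq degree_monom_eq monom_eq_0_iff)
  then show False using degW K by (simp add: N0_def N1_def algebra_simps)
qed

section \<open>Construction of the approximations\<close>

text \<open>Multiplied by X^i, the sum is a part of the binomial expansion of (X + Y)^(L + i). With
  X = |\<open>x j\<close>| and Y = \<open>y j\<close> the two factors are bounded by powers of g2
  and g4, which is how these constants arise.\<close>

lemma binomial_row_sum_le:
  fixes X Y :: real
  assumes "X > 0" "Y > 0"
  shows "(\<Sum>u<Suc L. of_nat ((L + i) choose u) * X ^ (L - u) * Y ^ u) \<le> (X + Y) ^ L * (1 + Y / X) ^ i"
proof -
  have "X ^ i * (\<Sum>u<Suc L. of_nat ((L + i) choose u) * X ^ (L - u) * Y ^ u)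
      = (\<Sum>u<Suc L. of_nat ((L + i) choose u) * Y ^ u * X ^ (L + i - u))"
    unfolding sum_distrib_left
  proof (intro sum.cong refl)
    fix u assume "u \<in> {..<Suc L}"
    then have "L + i - u = i + (L - u)" by simp
    then have "X ^ (L + i - u) = X ^ i * X ^ (L - u)" by (simp only: power_add)
    then show "X ^ i * (of_nat ((L + i) choose u) * X ^ (L - u) * Y ^ u)
        = of_nat ((L + i) choose u) * Y ^ u * X ^ (L + i - u)" by simp
  qed
  also have "\<dots> \<le> (\<Sum>u\<le>L + i. of_nat ((L + i) choose u) * Y ^ u * X ^ (L + i - u))"
    using assms by (intro sum_mono2) auto
  also have "\<dots> = (X + Y) ^ (L + i)" by (simp add: binomial_ring add.commute[of X])
  also have "\<dots> = X ^ i * ((X + Y) ^ L * (1 + Y / X) ^ i)"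
    using assms by (simp add: power_add power_divide field_simps flip: power_mult_distrib)
  finally show ?thesis using assms by simp
qed

text \<open>Since n! i! is at most (n + i)!, the tail is dominated by its leading factor times the
  full exponential series.\<close>

lemma exp_tail_bound:
  fixes v :: real
  assumes "v \<ge> 0"
  shows "summable (\<lambda>i. v ^ (i + n) / fact (i + n))"
    and "(\<Sum>i. v ^ (i + n) / fact (i + n)) \<le> v ^ n / fact n * exp v"
proof -
  have s: "(\<lambda>i. v ^ n / fact n * (v ^ i / fact i)) sums (v ^ n / fact n * exp v)"
    using sums_mult[OF exp_converges[of v], of "v ^ n / fact n"] by (simp add: divide_inverse mult_ac)
  have le: "v ^ (i + n) / fact (i + n) \<le> v ^ n / fact n * (v ^ i / fact i)" for i
  proof -
    have "fact n * fact i \<le> (fact (i + n) :: nat)"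
      using fact_fact_dvd_fact[of i n] by (intro dvd_imp_le) (auto simp: mult.commute)
    then have "fact n * fact i \<le> (fact (i + n) :: real)"
      by (metis of_nat_fact of_nat_mult of_nat_le_iff)
    then have "v ^ (i + n) / fact (i + n) \<le> v ^ (i + n) / (fact n * fact i)"
      using assms by (intro divide_left_mono) auto
    then show ?thesis by (simp add: power_add mult_ac)
  qed
  show sm: "summable (\<lambda>i. v ^ (i + n) / fact (i + n))"
    using le assms by (intro summable_comparison_test'[OF sums_summable[OF s]]) auto
  show "(\<Sum>i. v ^ (i + n) / fact (i + n)) \<le> v ^ n / fact n * exp v"
    using suminf_le[OF le sm sums_summable[OF s]] sums_unique[OF s] by simp
qed

lemma poly_1_eq_sum_coeff:
  fixes p :: "'a::comm_semiring_1 poly"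
  assumes "degree p \<le> n" shows "poly p 1 = (\<Sum>i\<le>n. coeff p i)"
  unfolding poly_altdef using assms
  by (intro sum.mono_neutral_cong_left) (auto intro: coeff_eq_0)

text \<open>The polynomial \<open>siegel_poly L c\<close> is normalized so that the Taylor coefficients of its
  product with an exponential have binomial coefficients as weights.\<close>

definition siegel_poly :: "nat \<Rightarrow> (nat \<Rightarrow> complex) \<Rightarrow> complex poly" where
  "siegel_poly L c = (\<Sum>u\<le>L. monom (fact L / fact u * c u) u)"

text \<open>Up to the factor \<open>fact L / fact N\<close>, this is the coefficient of index N in
  exp(a t) times the k-th derivative of \<open>siegel_poly L c\<close>.\<close>

definition exp_conv :: "(nat \<Rightarrow> complex) \<Rightarrow> nat \<Rightarrow> complex \<Rightarrow> nat \<Rightarrow> complex" where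
  "exp_conv c k a N = (\<Sum>u\<le>N. of_nat (N choose u) * a ^ (N - u) * c (u + k))"

context
  fixes L :: nat and c :: "nat \<Rightarrow> complex"
  assumes c_gt: "\<And>u. u > L \<Longrightarrow> c u = 0"
begin

lemma coeff_siegel_poly: "coeff (siegel_poly L c) u = fact L / fact u * c u"
  using c_gt by (simp add: siegel_poly_def coeff_sum)

lemma degree_siegel_poly: "degree (siegel_poly L c) \<le> L"
  by (intro degree_le) (simp add: coeff_siegel_poly c_gt)

text \<open>The weights 1 / u! make differentiation a mere shift of c, so the derivatives obey the
  same size and integrality estimates as the polynomial itself.\<close>

lemma coeff_pderiv_siegel_poly:
  "coeff ((pderiv ^^ k) (siegel_poly L c)) u = fact L / fact u * c (u + k)"
proof (induction k arbitrary: u)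
  case (Suc k)
  show ?case by (simp add: coeff_pderiv Suc field_simps del: of_nat_Suc)
qed (simp add: coeff_siegel_poly)

lemma fps_nth_exp_siegel_poly:
  "fps_nth (fps_exp a * fps_of_poly ((pderiv ^^ k) (siegel_poly L c))) N
    = fact L / fact N * exp_conv c k a N"
proof -
  have "fps_nth (fps_exp a * fps_of_poly ((pderiv ^^ k) (siegel_poly L c))) N
      = (\<Sum>u\<le>N. fact L / fact u * c (u + k) * (a ^ (N - u) / fact (N - u)))"
    by (subst mult.commute) (simp add: fps_mult_nth coeff_pderiv_siegel_poly atMost_atLeast0)
  also have "\<dots> = fact L / fact N * exp_conv c k a N"
    unfolding exp_conv_def sum_distrib_left
    by (intro sum.cong) (auto simp: binomial_fact field_simps)
  finally show ?thesis .
qed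

lemma norm_exp_conv_le:
  assumes "\<And>u. cmod (c u) \<le> X"
  shows "cmod (exp_conv c k a N) \<le> X * (1 + cmod a) ^ N"
proof -
  have "cmod (exp_conv c k a N) \<le> (\<Sum>u\<le>N. of_nat (N choose u) * cmod a ^ (N - u) * X)"
    unfolding exp_conv_def using assms
    by (intro sum_norm_le) (auto simp: norm_mult norm_power intro!: mult_left_mono)
  also have "\<dots> = X * (1 + cmod a) ^ N"
    by (subst binomial_ring) (simp add: sum_distrib_left mult_ac)
  finally show ?thesis .
qed

lemma norm_poly_siegel_poly_le:
  assumes "\<And>u. cmod (c u) \<le> X"
  shows "cmod (poly ((pderiv ^^ k) (siegel_poly L c)) 1) \<le> fact L * X * exp 1"
proof -
  have X: "X \<ge> 0" using assms[of 0] norm_ge_zero order.trans by blast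
  have deg: "degree ((pderiv ^^ k) (siegel_poly L c)) \<le> L"
    by (intro degree_le) (simp add: coeff_pderiv_siegel_poly c_gt)
  have "poly ((pderiv ^^ k) (siegel_poly L c)) 1 = (\<Sum>u\<le>L. fact L / fact u * c (u + k))"
    using poly_1_eq_sum_coeff[OF deg] by (simp only: coeff_pderiv_siegel_poly)
  also have "cmod \<dots> \<le> (\<Sum>u\<le>L. fact L / fact u * X)"
    using assms by (intro sum_norm_le) (auto simp: norm_mult norm_divide intro!: divide_right_mono)
  also have "\<dots> = fact L * X * (\<Sum>u\<le>L. 1 / fact u)"
    by (simp add: sum_distrib_left)
  also have "(\<Sum>u\<le>L. 1 / fact u) \<le> exp (1::real)"
    using sum_le_suminf[of "\<lambda>u. 1 / fact u :: real" "{..L}"] exp_converges[of "1::real"]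
    by (simp add: sums_iff divide_inverse)
  finally show ?thesis using X by (simp add: mult_left_mono)
qed

lemma exp_siegel_poly_sums:
  "(\<lambda>N. fact L / fact N * exp_conv c k a N) sums (exp a * poly ((pderiv ^^ k) (siegel_poly L c)) 1)"
proof -
  let ?p = "(pderiv ^^ k) (siegel_poly L c)"
  let ?f = "fps_exp a * fps_of_poly ?p"
  have "fps_conv_radius ?f \<ge> min (fps_conv_radius (fps_exp a)) (fps_conv_radius (fps_of_poly ?p))"
    by (rule fps_conv_radius_mult)
  then have inf: "fps_conv_radius ?f = \<infinity>" by simp
  have "(\<lambda>N. fps_nth ?f N * 1 ^ N) sums eval_fps ?f 1"
    by (rule sums_eval_fps) (simp add: inf)
  moreover have "eval_fps ?f 1 = exp a * poly ?p 1"
    by (simp add: eval_fps_mult)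
  ultimately show ?thesis by (simp add: fps_nth_exp_siegel_poly)
qed

text \<open>The coefficients between L and n vanish, so truncating at L amounts to truncating just
  before n, and only the tail from n on remains.\<close>

lemma exp_siegel_poly_remainder:
  assumes X: "\<And>u. cmod (c u) \<le> X"
    and van: "\<And>N. L < N \<Longrightarrow> N < n \<Longrightarrow> exp_conv c k a N = 0" and n: "L < n"
    and v: "1 + cmod a \<le> v"
  shows "cmod (exp a * poly ((pderiv ^^ k) (siegel_poly L c)) 1
      - (\<Sum>N\<le>L. fact L / fact N * exp_conv c k a N)) \<le> fact L * X * (v ^ n / fact n * exp v)"
proof -
  define f where "f N = fact L / fact N * exp_conv c k a N" for N
  have X0: "X \<ge> 0" using X[of 0] norm_ge_zero order.trans by blast
  have v0: "v \<ge> 0" using v norm_ge_zero[of a] by linarith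
  have "f sums (exp a * poly ((pderiv ^^ k) (siegel_poly L c)) 1)"
    unfolding f_def by (rule exp_siegel_poly_sums)
  then have "(\<lambda>i. f (i + n)) sums (exp a * poly ((pderiv ^^ k) (siegel_poly L c)) 1 - (\<Sum>N<n. f N))"
    by (rule sums_split_initial_segment)
  also have "(\<Sum>N<n. f N) = (\<Sum>N\<le>L. f N)"
    using n van by (intro sum.mono_neutral_right) (auto simp: f_def)
  finally have s: "(\<lambda>i. f (i + n)) sums (exp a * poly ((pderiv ^^ k) (siegel_poly L c)) 1 - (\<Sum>N\<le>L. f N))" .
  have le: "cmod (f (i + n)) \<le> fact L * X * (v ^ (i + n) / fact (i + n))" for i
  proof -
    have "cmod (exp_conv c k a (i + n)) \<le> X * v ^ (i + n)"
      using norm_exp_conv_le[OF X, of k a "i + n"] v X0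
      by (elim order.trans) (intro mult_left_mono power_mono, auto)
    then have "fact L / fact (i + n) * cmod (exp_conv c k a (i + n)) \<le> fact L / fact (i + n) * (X * v ^ (i + n))"
      by (rule mult_left_mono) simp
    then show ?thesis by (simp add: f_def norm_mult norm_divide mult_ac)
  qed
  have sm: "summable (\<lambda>i. fact L * X * (v ^ (i + n) / fact (i + n)))"
    using exp_tail_bound(1)[OF v0] by (rule summable_mult)
  have "cmod (suminf (\<lambda>i. f (i + n))) \<le> (\<Sum>i. fact L * X * (v ^ (i + n) / fact (i + n)))"
    by (rule norm_suminf_le[OF le sm])
  also have "\<dots> = fact L * X * (\<Sum>i. v ^ (i + n) / fact (i + n))"
    by (rule suminf_mult[OF exp_tail_bound(1)[OF v0]])
  also have "\<dots> \<le> fact L * X * (v ^ n / fact n * exp v)"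
    using X0 exp_tail_bound(2)[OF v0] by (intro mult_left_mono) auto
  finally show ?thesis using sums_unique[OF s] by (simp add: f_def)
qed

end

section \<open>Simultaneous approximations with integral values\<close>

context quadratic_order
begin

text \<open>The powers of x / y occurring have exponent at most N, N! divides L!, and
  \<open>y ^ N\<close> divides \<open>g ^ L\<close>. One factor thus clears every coefficient kept
  by the truncation.\<close>

lemma exp_conv_in_R:
  fixes x :: complex and y g L :: nat and c :: "nat \<Rightarrow> complex"
  assumes x: "x \<in> R" and y: "y > 0" "y dvd g" and g: "g > 0" and c: "\<And>u. c u \<in> R" and N: "N \<le> L"
  shows "of_nat (g ^ L) * (fact L / fact N * exp_conv c k (x / of_nat y) N) \<in> R"
proof -
  obtain d where d: "g = y * d" using y by (elim dvdE)
  have "of_nat (y ^ N) * exp_conv c k (x / of_nat y) N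
      = (\<Sum>u\<le>N. of_nat (N choose u) * x ^ (N - u) * of_nat (y ^ u) * c (u + k))"
    unfolding exp_conv_def sum_distrib_left
  proof (intro sum.cong refl)
    fix u assume "u \<in> {..N}"
    then have "(of_nat y :: complex) ^ N = of_nat y ^ (N - u) * of_nat y ^ u" by (simp flip: power_add)
    then show "of_nat (y ^ N) * (of_nat (N choose u) * (x / of_nat y) ^ (N - u) * c (u + k))
        = of_nat (N choose u) * x ^ (N - u) * of_nat (y ^ u) * c (u + k)"
      using y by (simp add: power_divide)
  qed
  also have "\<dots> \<in> R" using x c by (intro R_sum R_mult R_power R_of_nat)
  finally have 1: "of_nat (y ^ N) * exp_conv c k (x / of_nat y) N \<in> R" .
  have "fact N dvd (fact L :: nat)" using N by (rule fact_dvd)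
  then obtain w :: nat where w: "fact L = fact N * w" by (elim dvdE)
  have wc: "(fact L :: complex) = fact N * of_nat w"
    using arg_cong[OF w, of "of_nat :: nat \<Rightarrow> complex"] by simp
  have "of_nat (g ^ L) = (of_nat (y ^ N) :: complex) * of_nat (d ^ N * g ^ (L - N))"
  proof -
    have "g ^ L = g ^ N * g ^ (L - N)" using N by (simp flip: power_add)
    also have "g ^ N = y ^ N * d ^ N" by (simp add: d power_mult_distrib)
    finally show ?thesis by (simp only: mult.assoc of_nat_mult)
  qed
  then have "of_nat (g ^ L) * (fact L / fact N * exp_conv c k (x / of_nat y) N)
      = of_nat (d ^ N * g ^ (L - N) * w) * (of_nat (y ^ N) * exp_conv c k (x / of_nat y) N)"
    by (simp add: wc)
  also have "\<dots> \<in> R" by (intro R_mult R_of_nat 1)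
  finally show ?thesis .
qed

text \<open>Here q is the value at 1 of the k-th derivative of \<open>A 0\<close>, and
  \<open>r j\<close> is the error of the j-th derived numerator at 1. The numerators become elements
  of R after multiplication by \<open>g ^ L\<close>, and k is chosen so that their combination with
  the \<open>\<beta> j\<close> is nonzero. The condition \<open>K \<le> l j\<close> ensures that the
  gap of vanishing coefficients, shortened by k derivatives, still starts right above L.\<close>

lemma exp_approximations:
  fixes x \<alpha> \<beta> :: "nat \<Rightarrow> complex" and y l :: "nat \<Rightarrow> nat" and m L K :: nat
    and G2 G4 B v :: real
  assumes x: "\<And>j. j \<le> m \<Longrightarrow> x j \<in> R" and y: "\<And>j. j \<le> m \<Longrightarrow> y j > 0"
    and \<alpha>: "\<And>j. j \<le> m \<Longrightarrow> \<alpha> j = x j / of_nat (y j)" and \<alpha>0: "\<alpha> 0 = 0" and inj: "inj_on \<alpha> {0..m}"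
    and \<beta>: "\<And>j. j \<le> m \<Longrightarrow> \<beta> j \<in> R" "\<exists>j\<le>m. \<beta> j \<noteq> 0"
    and g: "g > 0" "\<And>j. j \<le> m \<Longrightarrow> y j dvd g"
    and G2: "\<And>j. j \<le> m \<Longrightarrow> cmod (x j) + y j \<le> G2" "G2 \<ge> 1"
    and G4: "\<And>j. j \<in> {1..m} \<Longrightarrow> 1 + y j / cmod (x j) \<le> G4" "G4 \<ge> 1"
    and v: "\<And>j. j \<le> m \<Longrightarrow> 1 + cmod (\<alpha> j) \<le> v"
    and lM: "(\<Sum>j=1..m. l j) \<le> L" and mL: "m \<le> L"
    and K: "K + 1 + (\<Sum>j=1..m. l j) > L + m * m" "K \<ge> m"
    and Kl: "\<And>j. j \<in> {1..m} \<Longrightarrow> K \<le> l j"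
    and B: "B \<ge> 1" "(\<Prod>j=1..m. \<Prod>i=1..l j. G2 ^ L * G4 ^ i) \<le> B ^ (L + 1 - (\<Sum>j=1..m. l j))"
  defines "X \<equiv> 10 * (1 + h) * (L + 1) * B"
  obtains k q r where "k \<le> K" "cmod q \<le> fact L * X * exp 1"
    "\<And>j. j \<in> {1..m} \<Longrightarrow>
      cmod (r j) \<le> fact L * X * (v ^ (L + l j - k + 1) / fact (L + l j - k + 1) * exp v)"
    "1 \<le> real g ^ L * cmod (q * (\<Sum>j\<le>m. \<beta> j * exp (\<alpha> j)) - (\<Sum>j=1..m. \<beta> j * r j))"
proof -
  define M where "M = (\<Sum>j=1..m. l j)"
  define I where "I = (SIGMA j:{1..m}. {1..l j})"
  have finI: "finite I" "card I = M" by (simp_all add: I_def M_def)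
  \<comment> \<open>Row (j, i) is the coefficient of index L + i in \<open>A 0\<close>
    exp(\<open>\<alpha> j\<close> t), multiplied by \<open>y j ^ L\<close> and divided by the common
    factor \<open>\<alpha> j ^ i\<close>. This makes the entries integral without letting i enter
    the power of \<open>x j\<close>.\<close>
  define a where "a = (\<lambda>(j, i) u. of_nat ((L + i) choose u) * x j ^ (L - u) * of_nat (y j) ^ u)"
  have xnz: "x j \<noteq> 0" if "j \<in> {1..m}" for j
  proof
    assume "x j = 0"
    then have "\<alpha> j = \<alpha> 0" using \<alpha>[of j] \<alpha>0 that by simp
    then show False using inj_onD[OF inj, of j 0] that by simp
  qed
  obtain c0 where c0: "\<And>u. u < L + 1 \<Longrightarrow> c0 u \<in> R" "\<exists>u<L + 1. c0 u \<noteq> 0"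
    "\<And>ji. ji \<in> I \<Longrightarrow> (\<Sum>u<L + 1. a ji u * c0 u) = 0"
    "\<And>u. u < L + 1 \<Longrightarrow> cmod (c0 u) \<le> 10 * (1 + h) * real (L + 1) * B"
  proof (rule siegel[of I "L + 1" a "\<lambda>(j, i). G2 ^ L * G4 ^ i" B])
    show "card I < L + 1" using finI lM by (simp add: M_def)
    show "a ji u \<in> R" if "ji \<in> I" for ji u
      using that x by (auto simp: a_def I_def intro!: R_mult R_power R_of_nat)
    show "(\<Sum>u<L + 1. cmod (a ji u)) \<le> (case ji of (j, i) \<Rightarrow> G2 ^ L * G4 ^ i)" if mem: "ji \<in> I" for ji
    proof -
      obtain j i where ji: "ji = (j, i)" "j \<in> {1..m}"
        using mem unfolding I_def by blast
      have "(\<Sum>u<L + 1. cmod (a ji u))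
          = (\<Sum>u<Suc L. of_nat ((L + i) choose u) * cmod (x j) ^ (L - u) * real (y j) ^ u)"
        by (simp add: ji a_def norm_mult norm_power)
      also have "\<dots> \<le> (cmod (x j) + y j) ^ L * (1 + y j / cmod (x j)) ^ i"
        using ji xnz[of j] y[of j] by (intro binomial_row_sum_le) auto
      also have "\<dots> \<le> G2 ^ L * G4 ^ i"
        using G2 G4(1)[of j] ji by (intro mult_mono power_mono) auto
      finally show ?thesis by (simp add: ji)
    qed
    show "1 \<le> (case ji of (j, i) \<Rightarrow> G2 ^ L * G4 ^ i)" for ji
      using mult_mono[OF one_le_power one_le_power, of G2 G4 L "snd ji"] G2 G4
      by (auto split: prod.splits)
    show "(\<Prod>ji\<in>I. case ji of (j, i) \<Rightarrow> G2 ^ L * G4 ^ i) \<le> B ^ (L + 1 - card I)"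
      using B(2) unfolding finI(2) M_def I_def by (subst prod.Sigma[symmetric]) auto
  qed (use finI B in auto)
  \<comment> \<open>Padding by zeros makes the shifted sequences of the derivatives available for
    all indices.\<close>
  define c where "c u = (if u < L + 1 then c0 u else 0)" for u
  have cR: "c u \<in> R" for u using c0(1) by (simp add: c_def)
  have c_gt: "c u = 0" if "u > L" for u using that by (simp add: c_def)
  have cX: "cmod (c u) \<le> X" for u
    using c0(4)[of u] Im_omega_pos B(1) by (auto simp: c_def X_def intro!: mult_nonneg_nonneg)
  define A0 where "A0 = siegel_poly L c"
  note nthF = fps_nth_exp_siegel_poly[of L c, OF c_gt, folded A0_def]
  have A0: "A0 \<noteq> 0" "degree A0 \<le> L"
  proof -
    obtain u where u: "u < L + 1" "c0 u \<noteq> 0" using c0(2) by blast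
    then have "coeff A0 u \<noteq> 0" using coeff_siegel_poly[of L c u] c_gt by (simp add: A0_def c_def)
    then show "A0 \<noteq> 0" by auto
    show "degree A0 \<le> L" unfolding A0_def using c_gt by (rule degree_siegel_poly)
  qed
  have van0: "exp_conv c 0 (\<alpha> j) N = 0" if j: "j \<in> {1..m}" and N: "L < N" "N \<le> L + l j" for j N
  proof -
    define i where "i = N - L"
    have i: "N = L + i" "i \<in> {1..l j}" using N by (auto simp: i_def)
    have yj: "of_nat (y j) \<noteq> (0 :: complex)" using y[of j] j by auto
    have "exp_conv c 0 (\<alpha> j) N = (\<Sum>u<L + 1. of_nat (N choose u) * \<alpha> j ^ (N - u) * c0 u)"
      unfolding exp_conv_def using N
      by (intro sum.mono_neutral_cong_right) (auto simp: c_def)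
    then have "of_nat (y j) ^ L * exp_conv c 0 (\<alpha> j) N
        = (\<Sum>u<L + 1. of_nat (y j) ^ L * (of_nat (N choose u) * \<alpha> j ^ (N - u) * c0 u))"
      by (simp only: sum_distrib_left)
    also have "\<dots> = (\<Sum>u<L + 1. \<alpha> j ^ i * (a (j, i) u * c0 u))"
    proof (intro sum.cong refl)
      fix u assume "u \<in> {..<L + 1}"
      then have u: "N - u = i + (L - u)" "L = (L - u) + u" by (auto simp: i)
      have "of_nat (y j) ^ L * \<alpha> j ^ (L - u) = x j ^ (L - u) * of_nat (y j) ^ u"
        using \<alpha>[of j] j yj by (subst u(2)) (simp add: power_add power_divide)
      then show "of_nat (y j) ^ L * (of_nat (N choose u) * \<alpha> j ^ (N - u) * c0 u)
          = \<alpha> j ^ i * (a (j, i) u * c0 u)"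
        unfolding u(1) by (simp add: a_def i(1) power_add mult_ac)
    qed
    also have "\<dots> = 0"
      using c0(3)[of "(j, i)"] i j by (simp add: I_def flip: sum_distrib_left)
    finally show ?thesis using yj by simp
  qed
  define E where "E j = fps_exp (\<alpha> j) * fps_of_poly A0" for j
  define A where "A j = (\<Sum>N\<le>L. monom (fps_nth (E j) N) N)" for j
  have coeffA: "coeff (A j) N = (if N \<le> L then fps_nth (E j) N else 0)" for j N
    by (simp add: A_def coeff_sum)
  have EN: "fps_nth (E j) N = 0" if "j \<in> {1..m}" "L < N" "N \<le> L + l j" for j N
    using van0[OF that] nthF[of "\<alpha> j" 0 N] by (simp add: E_def)
  have A0eq: "A 0 = A0"
  proof (rule poly_eqI)
    show "coeff (A 0) N = coeff A0 N" for N
      using A0(2) by (auto simp: coeffA E_def \<alpha>0 coeff_eq_0)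
  qed
  have diff_0: "fps_nth (fps_of_poly (A j) - E j) N = 0" if "j \<in> {1..m}" "N < L + l j + 1" for j N
    using EN[of j N] that by (auto simp: coeffA not_le)
  \<comment> \<open>Otherwise the whole series \<open>E j\<close> would vanish up to index L;
    dividing by the exponential, a unit, would annihilate \<open>A 0\<close>, whose degree is at
    most L.\<close>
  have Anz: "A j \<noteq> 0" if j: "j \<le> m" for j
  proof (cases "j = 0")
    case False
    show ?thesis
    proof
      assume "A j = 0"
      then have "fps_nth (E j) N = 0" if "N < L + 1" for N
        using coeffA[of j N] that by simp
      then have "fps_X ^ (L + 1) dvd E j" by (simp only: fps_X_power_dvd_iff) simp
      moreover have "fps_exp (\<alpha> j) dvd 1" by simp
      ultimately have "fps_X ^ (L + 1) dvd fps_of_poly A0"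
        unfolding E_def by (simp only: dvd_mult_unit_iff')
      then have "coeff A0 (degree A0) = 0" using A0(2) unfolding fps_X_power_dvd_iff by simp
      then show False using A0(1) by simp
    qed
  qed (use A0 A0eq in simp)
  have nsum: "(\<Sum>j=1..m. L + l j + 1 - m) + m * m = m * (L + 1) + M"
  proof -
    have "(\<Sum>j=1..m. L + l j + 1 - m) + m * m = (\<Sum>j=1..m. (L + l j + 1 - m) + m)"
      by (simp add: sum.distrib)
    also have "\<dots> = (\<Sum>j=1..m. (L + 1) + l j)" using mL by (intro sum.cong) auto
    also have "\<dots> = m * (L + 1) + M" unfolding sum.distrib M_def by simp
    finally show ?thesis .
  qed
  have "\<exists>k\<le>K. (\<Sum>j\<le>m. \<beta> j * poly ((exp_op (\<alpha> j) ^^ k) (A j)) 1) \<noteq> 0"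
  proof (rule exp_approx_nonvanishing[OF inj \<alpha>0, where n = "\<lambda>j. L + l j + 1" and L = L])
    show "degree (A j) \<le> L" for j by (intro degree_le) (simp add: coeffA)
    show "fps_nth (fps_of_poly (A j) - fps_exp (\<alpha> j) * fps_of_poly (A 0)) i = 0"
      if "j \<in> {1..m}" "i < L + l j + 1" for j i
      using diff_0[OF that] by (simp add: E_def A0eq)
    show "K + 1 + (\<Sum>j=1..m. L + l j + 1 - m) > (m + 1) * L + m"
      using K(1) nsum by (simp add: M_def algebra_simps)
  qed (use Anz \<beta>(2) K(2) in auto)
  then obtain k where k: "k \<le> K" "(\<Sum>j\<le>m. \<beta> j * poly ((exp_op (\<alpha> j) ^^ k) (A j)) 1) \<noteq> 0"
    by blast
  define p where "p j = poly ((exp_op (\<alpha> j) ^^ k) (A j)) 1" for j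
  define q where "q = poly ((pderiv ^^ k) A0) 1"
  define r where "r j = exp (\<alpha> j) * q - p j" for j
  have opE: "(fps_exp_op (\<alpha> j) ^^ k) (E j) = fps_exp (\<alpha> j) * fps_of_poly ((pderiv ^^ k) A0)" for j
  proof -
    have "(fps_deriv ^^ k) (fps_of_poly A0) = fps_of_poly ((pderiv ^^ k) A0)"
      by (induction k) (simp_all add: fps_of_poly_pderiv)
    then show ?thesis unfolding E_def by (simp add: fps_exp_op_power_exp)
  qed
  have p_eq: "p j = (\<Sum>N\<le>L. fact L / fact N * exp_conv c k (\<alpha> j) N)" if j: "j \<in> {1..m}" for j
  proof -
    have "degree (A j) \<le> L" by (intro degree_le) (simp add: coeffA)
    then have "p j = (\<Sum>N\<le>L. coeff ((exp_op (\<alpha> j) ^^ k) (A j)) N)"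
      unfolding p_def by (intro poly_1_eq_sum_coeff degree_exp_op)
    also have "\<dots> = (\<Sum>N\<le>L. fact L / fact N * exp_conv c k (\<alpha> j) N)"
    proof (intro sum.cong refl)
      fix N assume "N \<in> {..L}"
      \<comment> \<open>Up to index L the truncation error of \<open>A j\<close> does not yet
        contribute after k applications, so derivation commutes with truncation there.\<close>
      then have N: "N + k < L + l j + 1" using k(1) Kl[OF j] by simp
      have "coeff ((exp_op (\<alpha> j) ^^ k) (A j)) N = fps_nth ((fps_exp_op (\<alpha> j) ^^ k) (fps_of_poly (A j) - E j + E j)) N"
        by (simp flip: fps_of_poly_exp_op_power)
      also have "\<dots> = fps_nth ((fps_exp_op (\<alpha> j) ^^ k) (fps_of_poly (A j) - E j)) N
          + fps_nth ((fps_exp_op (\<alpha> j) ^^ k) (E j)) N"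
        using fps_exp_op_power_diff[of k "\<alpha> j" "fps_of_poly (A j) - E j + E j" "E j"]
        by (simp add: fps_eq_iff algebra_simps)
      also have "fps_nth ((fps_exp_op (\<alpha> j) ^^ k) (fps_of_poly (A j) - E j)) N = 0"
        using N diff_0[OF j] by (intro fps_exp_op_power_nth_eq_0[of 0 "L + l j + 1"]) auto
      finally show "coeff ((exp_op (\<alpha> j) ^^ k) (A j)) N = fact L / fact N * exp_conv c k (\<alpha> j) N"
        by (simp add: opE nthF)
    qed
    finally show ?thesis .
  qed
  have p0: "p 0 = q"
  proof -
    have "exp_op 0 = pderiv" by (simp add: exp_op_def fun_eq_iff)
    then show ?thesis by (simp add: p_def q_def \<alpha>0 A0eq)
  qed
  have q_eq: "q = (\<Sum>N\<le>L. fact L / fact N * exp_conv c k 0 N)"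
  proof -
    have "degree ((exp_op 0 ^^ k) A0) \<le> L" using A0(2) by (rule degree_exp_op)
    moreover have "exp_op 0 = pderiv" by (simp add: exp_op_def fun_eq_iff)
    ultimately have "q = (\<Sum>N\<le>L. coeff ((pderiv ^^ k) A0) N)"
      unfolding q_def by (intro poly_1_eq_sum_coeff) simp
    then show ?thesis using nthF[of 0 k] by simp
  qed
  have pR: "of_nat (g ^ L) * p j \<in> R" if j: "j \<le> m" for j
  proof -
    have "p j = (\<Sum>N\<le>L. fact L / fact N * exp_conv c k (\<alpha> j) N)"
      using p_eq[of j] p0 q_eq j \<alpha>0 by (cases "j = 0") auto
    then have "of_nat (g ^ L) * p j = (\<Sum>N\<le>L. of_nat (g ^ L) * (fact L / fact N * exp_conv c k (x j / of_nat (y j)) N))"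
      using \<alpha>[OF j] by (simp only: sum_distrib_left)
    also have "\<dots> \<in> R"
      using x[OF j] y[OF j] g(2)[OF j] g(1) cR by (intro R_sum exp_conv_in_R) auto
    finally show ?thesis .
  qed
  have vanE: "exp_conv c k (\<alpha> j) N = 0" if j: "j \<in> {1..m}" and N: "L < N" "N < L + l j - k + 1" for j N
  proof -
    have "fps_nth ((fps_exp_op (\<alpha> j) ^^ k) (E j)) N = 0"
      using N EN[OF j] by (intro fps_exp_op_power_nth_eq_0[of "L + 1" "L + l j + 1"]) auto
    then show ?thesis by (simp add: opE nthF)
  qed
  show ?thesis
  proof (rule that[of k q r])
    show "cmod q \<le> fact L * X * exp 1"
      unfolding q_def A0_def using c_gt cX by (rule norm_poly_siegel_poly_le)
    show "cmod (r j) \<le> fact L * X * (v ^ (L + l j - k + 1) / fact (L + l j - k + 1) * exp v)"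
      if j: "j \<in> {1..m}" for j
      unfolding r_def p_eq[OF j] q_def A0_def
      using c_gt cX vanE[OF j] v[of j] j k(1) Kl[OF j]
      by (intro exp_siegel_poly_remainder) auto
    have "(\<Sum>j\<le>m. \<beta> j * p j) = (\<Sum>j\<le>m. \<beta> j * (exp (\<alpha> j) * q)) - (\<Sum>j\<le>m. \<beta> j * r j)"
      by (simp add: r_def algebra_simps flip: sum_subtractf sum.distrib)
    \<comment> \<open>As \<open>\<alpha> 0\<close> = 0, the approximation for index 0 is exact and
      has no remainder.\<close>
    also have "(\<Sum>j\<le>m. \<beta> j * r j) = (\<Sum>j=1..m. \<beta> j * r j)"
      using p0 \<alpha>0 by (intro sum.mono_neutral_right) (auto simp: r_def Suc_le_eq)
    also have "(\<Sum>j\<le>m. \<beta> j * (exp (\<alpha> j) * q)) = q * (\<Sum>j\<le>m. \<beta> j * exp (\<alpha> j))"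
      by (simp add: sum_distrib_left mult_ac)
    finally have eq: "q * (\<Sum>j\<le>m. \<beta> j * exp (\<alpha> j)) - (\<Sum>j=1..m. \<beta> j * r j) = (\<Sum>j\<le>m. \<beta> j * p j)"
      by simp
    have "of_nat (g ^ L) * (\<Sum>j\<le>m. \<beta> j * p j) = (\<Sum>j\<le>m. \<beta> j * (of_nat (g ^ L) * p j))"
      by (simp add: sum_distrib_left mult_ac)
    also have "\<dots> \<in> R" by (intro R_sum R_mult[OF \<beta>(1) pR]) auto
    finally have "1 \<le> cmod (of_nat (g ^ L) * (\<Sum>j\<le>m. \<beta> j * p j))"
      using k(2) g(1) by (intro cmod_ge_1) (auto simp: p_def)
    then show "1 \<le> real g ^ L * cmod (q * (\<Sum>j\<le>m. \<beta> j * exp (\<alpha> j)) - (\<Sum>j=1..m. \<beta> j * r j))"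
      unfolding eq by (simp add: norm_mult norm_power)
  qed (rule k(1))
qed

end

section \<open>Choice of the parameters\<close>

lemma mult_ln_mono:
  fixes a b :: real
  assumes "1 \<le> a" "a \<le> b" shows "a * ln a \<le> b * ln b"
  using assms by (intro mult_mono) auto

text \<open>L is the least integer with L ln L at least T. Failure at L - 1 bounds the overshoot,
  because (L - 1) (ln L - ln (L - 1)) is at most 1.\<close>

lemma exists_nat_mult_ln:
  fixes T z :: real
  assumes T: "T > 0" and z: "z \<ge> 3" "T \<le> (z - 1) * ln (z - 1)"
  obtains L :: nat where "2 \<le> L" "real L \<le> z" "T \<le> L * ln L" "L * ln L \<le> T + 1 + ln L"
proof -
  define P where "P n \<longleftrightarrow> T \<le> real n * ln (real n)" for n :: nat
  define L where "L = (LEAST n. P n)"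
  define N where "N = nat \<lfloor>z\<rfloor>"
  have N: "real N \<le> z" "z - 1 \<le> real N" using z(1) by (simp_all add: N_def)
  have "(z - 1) * ln (z - 1) \<le> N * ln N" using z N by (intro mult_ln_mono) auto
  then have PN: "P N" using z(2) by (simp add: P_def)
  have PL: "P L" unfolding L_def using PN by (rule LeastI)
  have L2: "L \<ge> 2"
  proof (rule ccontr)
    assume "\<not> L \<ge> 2"
    then have "L = 0 \<or> L = 1" by auto
    then show False using PL T by (auto simp: P_def)
  qed
  have "L \<le> N" unfolding L_def using PN by (rule Least_le)
  moreover have "L * ln L \<le> T + 1 + ln L"
  proof -
    have "\<not> P (L - 1)" using not_less_Least[of "L - 1" P] L2 by (simp add: L_def)
    then have less: "(real L - 1) * ln (real L - 1) < T" using L2 by (simp add: P_def of_nat_diff)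
    have "ln (real L) - ln (real L - 1) = ln (real L / (real L - 1))"
      using L2 by (subst ln_div) auto
    also have "\<dots> \<le> real L / (real L - 1) - 1" using L2 by (intro ln_le_minus_one) auto
    also have "\<dots> = 1 / (real L - 1)" using L2 by (simp add: field_simps)
    finally have "(real L - 1) * (ln (real L) - ln (real L - 1)) \<le> 1"
      using L2 by (simp add: field_simps)
    then show ?thesis using less by (simp add: algebra_simps)
  qed
  ultimately show ?thesis using that[of L] L2 PL N by (simp add: P_def)
qed

text \<open>\<open>L\<close> is the degree of the approximations. The choice of \<open>\<Theta>\<close> leaves a margin of order
  \<open>z sqrt (ln z)\<close> in both conclusions, and since \<open>ln z\<close> is at least \<open>81 m\<^sup>2 s\<^sup>2\<close> this margin absorbs
  all lower order terms.\<close>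

lemma parameters:
  fixes m :: nat and s lam b e b' e' lG1 v z hh :: real
  assumes m: "m \<ge> 2" and s: "s > 0" "s\<^sup>2 \<ge> 2 / 3"
    and lam: "0 \<le> lam" "lam \<le> s\<^sup>2"
    and b: "b = s + lam / (2 * s)" and e: "e = b + 2 * s"
    and v: "v \<ge> 1" "v \<le> exp (s\<^sup>2)"
    and e': "0 \<le> e'" "e' \<ge> lG1 + 2 * ln v - s\<^sup>2 - lam" "e' \<le> (real m + 7) * s\<^sup>2"
    and b': "0 \<le> b'" "b' \<ge> lG1 - s\<^sup>2 - lam"
    and lG1: "lG1 \<ge> 0"
    and z: "z > 0" "z * ln z = 2 * hh" "ln z \<ge> (3 * real m * e)\<^sup>2"
  obtains L :: nat where "2 \<le> L" "real L \<le> z" "m \<le> L" "s * L > sqrt (ln L)"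
    "hh + m * (L * lG1 + ln (20 * exp (s\<^sup>2) * (L + 1)) + b * L * sqrt (ln L) + v + 2 * L * ln v)
       + (m + 1) * s * L * sqrt (ln L) + (m ^ 3 + m + 1) * ln L \<le> L * ln L"
    "L * lG1 + L * ln L + ln (20 * exp (s\<^sup>2) * (L + 1)) + b * L * sqrt (ln L) + 1
       < hh + (b + m * e) * (z * sqrt (ln z)) + (1 + b + b' + e' * m) * z + m * ln z"
proof -
  define u w where "u = ln z" and "w = sqrt u"
  have m2: "real m \<ge> 2" using m by simp
  have b0_ge: "b \<ge> s" using lam s by (simp add: b)
  have e0_ge: "e \<ge> 3 * s" using b0_ge by (simp add: e)
  have e0_le: "0 \<le> 3 * real m * e" using e0_ge s by simp
  have u_ge: "(3 * real m * e)\<^sup>2 \<le> u" using z by (simp add: u_def)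
  have w_e0: "3 * real m * e \<le> w" unfolding w_def using u_ge by (rule real_le_rsqrt)
  have "9 * real m * s = 3 * real m * (3 * s)" by simp
  also have "\<dots> \<le> 3 * real m * e" using e0_ge by (intro mult_left_mono) auto
  also note w_e0
  finally have w_ge: "9 * real m * s \<le> w" .
  have u_ms: "81 * ((real m)\<^sup>2 * s\<^sup>2) \<le> u"
  proof -
    have "(9 * real m * s)\<^sup>2 \<le> (3 * real m * e)\<^sup>2"
      using e0_ge s mult_left_mono[OF e0_ge, of "3 * real m"] by (intro power_mono) auto
    also have "(9 * real m * s)\<^sup>2 = 81 * ((real m)\<^sup>2 * s\<^sup>2)" by (simp add: power_mult_distrib)
    finally show ?thesis using u_ge by linarith
  qed
  have m_sq: "(real m)\<^sup>2 \<ge> 4" using power_mono[OF m2, of 2] by simp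
  \<comment> \<open>The bound 2 / 3 for \<open>s\<^sup>2\<close> turns 81 into 54, and m^2 at least
    4 then gives 216 = 8 * 27, as needed for comparing exp u with (u / 3)^3.\<close>
  have u_m: "54 * (real m)\<^sup>2 \<le> u"
    using mult_left_mono[OF s(2), of "81 * (real m)\<^sup>2"] u_ms by (simp add: mult.commute)
  have u216: "u \<ge> 216" using u_m m_sq by linarith
  have u_s: "324 * s\<^sup>2 \<le> u"
    using mult_right_mono[OF m_sq, of "s\<^sup>2"] u_ms by simp
  have uu: "w * w = u" using u216 by (simp add: w_def)
  have w0: "w \<ge> 0" using u216 by (simp add: w_def)
  have zexp: "z = exp u" using z(1) by (simp add: u_def)
  have z_uu: "8 * u\<^sup>2 \<le> z"
  proof -
    have "8 * u\<^sup>2 \<le> u / 27 * u\<^sup>2" using u216 by (intro mult_right_mono) auto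
    also have "\<dots> = (u / 3) ^ 3" by (simp add: power3_eq_cube power2_eq_square)
    also have "\<dots> \<le> (1 + u / 3) ^ 3" using u216 by (intro power_mono) auto
    also have "\<dots> \<le> exp u" using exp_ge_one_plus_x_over_n_power_n[of 3 u] u216 by simp
    finally show ?thesis using zexp by simp
  qed
  have u_uu: "216 * u \<le> u\<^sup>2" using u216 by (simp add: power2_eq_square)
  have z_v: "100 * v \<le> z"
  proof -
    have "100 * v \<le> (1 + (u - s\<^sup>2)) * exp (s\<^sup>2)"
      using v u_s u216 by (intro mult_mono) auto
    also have "\<dots> \<le> exp (u - s\<^sup>2) * exp (s\<^sup>2)"
      by (intro mult_right_mono exp_ge_add_one_self) auto
    also have "\<dots> = z" by (simp add: zexp flip: exp_add)
    finally show ?thesis .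
  qed
  have zbig: "z \<ge> 1000" using z_uu u_uu u216 by linarith
  have szw: "(9 * real m * s\<^sup>2) * z \<le> s * z * w"
    using mult_left_mono[OF w_ge, of "s * z"] s z(1) by (simp add: power2_eq_square algebra_simps)
  have szw': "18 * s\<^sup>2 * z \<le> s * z * w"
  proof -
    have "2 * (9 * s\<^sup>2 * z) \<le> real m * (9 * s\<^sup>2 * z)"
      using m2 z(1) by (intro mult_right_mono) auto
    also have "\<dots> = (9 * real m * s\<^sup>2) * z" by simp
    finally show ?thesis using szw by linarith
  qed
  have zs: "2 / 3 * z \<le> s\<^sup>2 * z" using s(2) z(1) by (intro mult_right_mono) auto
  \<comment> \<open>The first conclusion needs the coefficient m b + (m + 1) s of z w, which is m e
    - (m - 1) s. Stopping at m e - s / 2 leaves (m - 3 / 2) s for its lower order terms and s / 2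
    for those of the second conclusion.\<close>
  define \<Theta> where "\<Theta> = m * e - s / 2"
  define T where "T = hh + \<Theta> * (z * w) + m * e' * z"
  have \<Theta>0: "\<Theta> \<ge> 0"
  proof -
    have "1 * (3 * s) \<le> m * e" using m2 e0_ge s by (intro mult_mono) auto
    then show ?thesis using s by (simp add: \<Theta>_def)
  qed
  have hh: "hh = z * u / 2" using z(2) by (simp add: u_def)
  have T_ge: "hh \<le> T" unfolding T_def using \<Theta>0 z(1) w0 e'(1) by simp
  have hh0: "hh > 0" using z(1) u216 by (simp add: hh)
  \<comment> \<open>The three summands of T are 1/2, at most 1/3 (as 3 m e is at most w) and at most
    1/18 of z u. A sum below 1 leaves room for passing from z to z - 1.\<close>
  have T_le: "T \<le> 8 / 9 * (z * u)"
  proof -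
    have "3 * \<Theta> \<le> w" using w_e0 s by (simp add: \<Theta>_def)
    then have "3 * \<Theta> * (z * w) \<le> w * (z * w)" using z(1) w0 by (intro mult_right_mono) auto
    also have "\<dots> = z * u" using uu by (simp add: mult_ac)
    finally have 1: "\<Theta> * (z * w) \<le> z * u / 3" by simp
    have "m * e' \<le> m * ((m + 7) * s\<^sup>2)" using e'(3) by (intro mult_left_mono) auto
    also have "\<dots> = (m * m + 7 * m) * s\<^sup>2" by (simp add: algebra_simps)
    also have "\<dots> \<le> (9 / 2 * (real m)\<^sup>2) * s\<^sup>2"
      using m2 mult_right_mono[OF m2, of "real m"]
      by (intro mult_right_mono) (auto simp: power2_eq_square)
    also have "\<dots> \<le> u / 18" using u_ms by (simp add: mult.commute)
    finally have "m * e' * z \<le> u / 18 * z" using z(1) by (intro mult_right_mono) auto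
    then show ?thesis using 1 by (simp add: T_def hh algebra_simps)
  qed
  have T_le': "T \<le> (z - 1) * ln (z - 1)"
  proof -
    have "u - 1 = ln (z / exp 1)" using z(1) by (simp add: ln_div u_def)
    also have "\<dots> \<le> ln (z - 1)"
    proof -
      have "z / exp 1 \<le> z / 2"
        using z(1) exp_ge_add_one_self[of 1] by (intro divide_left_mono) auto
      then have "z / exp 1 \<le> z - 1" using zbig by linarith
      then show ?thesis using z(1) zbig by (intro ln_mono) auto
    qed
    finally have "(z - 1) * (u - 1) \<le> (z - 1) * ln (z - 1)" using zbig by (intro mult_left_mono) auto
    moreover have "8 / 9 * (z * u) \<le> (z - 1) * (u - 1)"
    proof -
      have "z * 216 \<le> z * u" using u216 z(1) by (intro mult_left_mono) auto
      moreover have "(z - 1) * (u - 1) = z * u - z - u + 1" by (simp add: algebra_simps)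
      ultimately show ?thesis using z_uu u_uu u216 by linarith
    qed
    ultimately show ?thesis using T_le by linarith
  qed
  obtain L :: nat where L: "2 \<le> L" "real L \<le> z" "T \<le> L * ln L" "L * ln L \<le> T + 1 + ln L"
    using exists_nat_mult_ln[of T z] T_ge hh0 zbig T_le' by auto
  have lnL: "ln L \<le> u" "0 < ln L" using L(1,2) by (auto simp: u_def)
  have rt: "sqrt (ln L) \<le> w" "0 < sqrt (ln L)" unfolding w_def using lnL by simp_all
  have Lrt: "L * sqrt (ln L) \<le> z * w" using L(2) rt z(1) by (intro mult_mono) auto
  define Q where "Q = ln (20 * exp (s\<^sup>2) * (L + 1))"
  have Q: "Q \<le> 3 * u"
  proof -
    have "Q = ln 20 + s\<^sup>2 + ln (real L + 1)"
      by (simp add: Q_def ln_mult add.commute)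
    moreover have "ln (20::real) \<le> 19" using ln_le_minus_one[of 20] by simp
    moreover have "ln (real L + 1) \<le> u + 1"
    proof -
      have "real L + 1 \<le> 2 * z" using L(2) zbig by linarith
      also have "\<dots> \<le> exp 1 * z"
        using z(1) exp_ge_add_one_self[of 1] by (intro mult_right_mono) auto
      finally have "ln (real L + 1) \<le> ln (exp 1 * z)" using z(1) by (intro ln_mono) auto
      then show ?thesis using z(1) by (simp add: ln_mult u_def)
    qed
    ultimately show ?thesis using u_s u216 by linarith
  qed
  have mL: "m \<le> L"
  proof (rule ccontr)
    assume "\<not> m \<le> L"
    then have "real L \<le> m" by simp
    then have "L * ln L \<le> m * u" using lnL by (intro mult_mono) auto
    also have "\<dots> \<le> (real m)\<^sup>2 * u"
      using m2 u216 by (intro mult_right_mono) (auto simp: power2_eq_square)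
    also have "\<dots> \<le> u / 54 * u" using u_m u216 by (intro mult_right_mono) auto
    also have "\<dots> < z / 2 * u" using z_uu u_uu u216 by (intro mult_strict_right_mono) auto
    finally show False using L(3) T_ge hh by simp
  qed
  have sL: "s * L > sqrt (ln L)"
  proof -
    have LL: "2 * real L \<le> real L * real L" using L(1) by (intro mult_right_mono) auto
    have "ln L \<le> real L - 1" using L(1) by (intro ln_le_minus_one) auto
    also have "\<dots> < 2 / 3 * (real L * real L)"
      using LL L(1) by linarith
    also have "\<dots> \<le> s\<^sup>2 * (real L * real L)" using s(2) by (intro mult_right_mono) auto
    also have "\<dots> = (s * L)\<^sup>2" by (simp add: power2_eq_square mult_ac)
    finally show ?thesis using s(1) L(1) by (intro real_less_lsqrt) auto
  qed
  have star: "hh + m * (L * lG1 + Q + b * L * sqrt (ln L) + v + 2 * L * ln v)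
       + (m + 1) * s * L * sqrt (ln L) + (m ^ 3 + m + 1) * ln L \<le> L * ln L"
  proof -
    have "L * lG1 + 2 * L * ln v = L * (lG1 + 2 * ln v)" by (simp add: algebra_simps)
    also have "\<dots> \<le> z * (lG1 + 2 * ln v)" using L(2) lG1 v(1) by (intro mult_right_mono) auto
    also have "\<dots> \<le> z * (e' + 2 * s\<^sup>2)" using e'(2) lam z(1) by (intro mult_left_mono) auto
    finally have 1: "L * lG1 + 2 * L * ln v \<le> z * e' + 2 * s\<^sup>2 * z" by (simp add: algebra_simps)
    have 2: "b * L * sqrt (ln L) \<le> b * (z * w)"
      using mult_left_mono[OF Lrt, of b] b0_ge s by (simp add: mult_ac)
    have "L * lG1 + Q + b * L * sqrt (ln L) + v + 2 * L * ln v
        \<le> z * e' + 2 * s\<^sup>2 * z + 3 * u + b * (z * w) + v"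
      using 1 2 Q by linarith
    then have 3: "m * (L * lG1 + Q + b * L * sqrt (ln L) + v + 2 * L * ln v)
        \<le> m * (z * e' + 2 * s\<^sup>2 * z + 3 * u + b * (z * w) + v)"
      by (intro mult_left_mono) auto
    have 4: "(m + 1) * s * L * sqrt (ln L) \<le> (m + 1) * s * (z * w)"
      using mult_left_mono[OF Lrt, of "(m + 1) * s"] s by (simp add: mult_ac)
    have 5: "(m ^ 3 + m + 1) * ln L \<le> m * (((real m)\<^sup>2 + 2) * u)"
    proof -
      have "(m ^ 3 + m + 1) * ln L \<le> (m ^ 3 + m + 1) * u" using lnL by (intro mult_left_mono) auto
      also have "\<dots> \<le> (m * ((real m)\<^sup>2 + 2)) * u"
        using m2 u216 by (intro mult_right_mono) (auto simp: power2_eq_square power3_eq_cube algebra_simps)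
      finally show ?thesis by simp
    qed
    have 6: "m * (2 * s\<^sup>2 * z + 3 * u + v + ((real m)\<^sup>2 + 2) * u) \<le> (m - 3 / 2) * (s * z * w)"
    proof -
      have "((real m)\<^sup>2 + 2) * u + 3 * u = ((real m)\<^sup>2 + 5) * u" by (simp add: algebra_simps)
      also have "\<dots> \<le> u * u" using u_m u216 by (intro mult_right_mono) auto
      finally have "((real m)\<^sup>2 + 2) * u + 3 * u \<le> z / 8"
        using z_uu by (simp add: power2_eq_square)
      then have "2 * s\<^sup>2 * z + 3 * u + v + ((real m)\<^sup>2 + 2) * u \<le> 9 / 2 * s\<^sup>2 * z"
        using z_v zs z(1) by linarith
      also have "\<dots> \<le> 1 / 4 * (s * z * w)" using szw' by linarith
      finally have "m * (2 * s\<^sup>2 * z + 3 * u + v + ((real m)\<^sup>2 + 2) * u) \<le> m * (1 / 4 * (s * z * w))"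
        by (intro mult_left_mono) auto
      also have "\<dots> = m / 4 * (s * z * w)" by simp
      also have "\<dots> \<le> (m - 3 / 2) * (s * z * w)"
        using m2 s z(1) w0 by (intro mult_right_mono) auto
      finally show ?thesis .
    qed
    have "hh + m * (z * e' + 2 * s\<^sup>2 * z + 3 * u + b * (z * w) + v) + (m + 1) * s * (z * w)
        + m * (((real m)\<^sup>2 + 2) * u)
      = hh + m * b * (z * w) + m * e' * z + (m + 1) * s * (z * w)
        + m * (2 * s\<^sup>2 * z + 3 * u + v + ((real m)\<^sup>2 + 2) * u)"
      by (simp add: algebra_simps)
    also have "\<dots> \<le> hh + m * b * (z * w) + m * e' * z + (m + 1) * s * (z * w)
        + (m - 3 / 2) * (s * z * w)"
      using 6 by linarith
    also have "\<dots> = T" by (simp add: T_def \<Theta>_def e algebra_simps)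
    finally show ?thesis using 3 4 5 L(3) by linarith
  qed
  have final: "L * lG1 + L * ln L + Q + b * L * sqrt (ln L) + 1
       < hh + (b + m * e) * (z * w) + (1 + b + b' + e' * m) * z + m * u"
  proof -
    have "L * lG1 \<le> z * lG1" using L(2) lG1 by (intro mult_right_mono) auto
    also have "\<dots> \<le> z * (b' + 2 * s\<^sup>2)" using b'(2) lam z(1) by (intro mult_left_mono) auto
    finally have 1: "L * lG1 \<le> z * b' + 2 * s\<^sup>2 * z" by (simp add: algebra_simps)
    have 2: "b * L * sqrt (ln L) \<le> b * (z * w)"
      using mult_left_mono[OF Lrt, of b] b0_ge s by (simp add: mult_ac)
    have 3: "0 \<le> b * z" "0 \<le> real m * u" using b0_ge s z(1) u216 by simp_all
    have "2 * s\<^sup>2 * z + 4 * u + 2 < 1 / 2 * (s * z * w) + z"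
      using szw' zs z_uu u_uu u216 z(1) by linarith
    moreover have "T = hh + m * e * (z * w) - 1 / 2 * (s * z * w) + e' * m * z"
      by (simp add: T_def \<Theta>_def algebra_simps)
    moreover have "hh + (b + m * e) * (z * w) + (1 + b + b' + e' * m) * z + m * u
        = hh + b * (z * w) + m * e * (z * w) + z + b * z + z * b' + e' * m * z + m * u"
      by (simp add: algebra_simps)
    ultimately show ?thesis using 1 2 3 L(4) Q lnL by linarith
  qed
  show ?thesis
    using that[OF L(1,2) mL sL] star final by (simp add: Q_def u_def w_def)
qed

section \<open>The lower bound\<close>

text \<open>The intermediate value theorem applies on [e, t]: the value at e is e, at most t, and
  the value at t is at least t because ln t is at least 1.\<close>

lemma z_fun_props:
  assumes "t \<ge> exp 1"
  shows "z_fun t \<ge> exp 1" "z_fun t * ln (z_fun t) = t"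
proof -
  let ?f = "\<lambda>z::real. z * ln z"
  have inj: "inj_on ?f {exp 1..}"
  proof (rule linorder_inj_onI)
    fix a b :: real assume ab: "a < b" "a \<in> {exp 1..}" "b \<in> {exp 1..}"
    have "0 < a" using ab(2) less_le_trans[OF exp_gt_zero] by simp
    moreover have "1 \<le> ln a" using ab(2) \<open>0 < a\<close> by (simp add: ln_ge_iff)
    moreover have "ln a < ln b" using ab \<open>0 < a\<close> by simp
    ultimately have "a * ln a < b * ln b" using ab(1) by (intro mult_strict_mono) linarith+
    then show "?f a \<noteq> ?f b" by simp
  qed auto
  have tt: "t \<le> t * ln t"
    using assms ln_mono[of "exp 1" t] less_le_trans[OF exp_gt_zero assms] by simp
  have "\<exists>z\<ge>exp 1. z \<le> t \<and> ?f z = t"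
  proof (rule IVT')
    show "continuous_on {exp 1..t} ?f"
      by (intro continuous_intros) (auto dest: less_le_trans[OF exp_gt_zero])
  qed (use assms tt in auto)
  then obtain z where z: "z \<in> {exp 1..}" "?f z = t" by auto
  have "z_fun t = z" unfolding z_fun_def using the_inv_into_f_f[OF inj z(1)] z(2) by simp
  then show "z_fun t \<ge> exp 1" "z_fun t * ln (z_fun t) = t" using z by auto
qed

text \<open>Every factor beyond L is at least L. Each further vanishing coefficient therefore gains
  a factor L in the remainder.\<close>

lemma fact_mult_power_le:
  assumes "L \<le> n" shows "fact L * L ^ (n - L) \<le> (fact n :: nat)"
  using assms
proof (induction n rule: dec_induct)
  case (step n)
  have "fact L * L ^ (Suc n - L) = L * (fact L * L ^ (n - L))"
    using step by (simp add: Suc_diff_le)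
  also have "\<dots> \<le> Suc n * fact n" using step by (intro mult_mono) auto
  finally show ?case by simp
qed simp

context quadratic_order
begin

text \<open>Making the j-th remainder small takes about ln(2 m \<open>Hs j\<close>) / ln L vanishing
  coefficients beyond fixed costs. Summed over j this is ln H / ln L, which must stay below L. The
  assumption on h bounds the factor 10 (1 + h) from Siegel's lemma by 20 g2.\<close>

lemma linear_form_lower_bound:
  fixes m :: nat and \<alpha> x \<beta> :: "nat \<Rightarrow> complex" and y :: "nat \<Rightarrow> nat"
    and Hs :: "nat \<Rightarrow> real" and H :: real
  assumes m: "m \<ge> 2"
    and x: "\<And>j. j \<le> m \<Longrightarrow> x j \<in> R" and y: "\<And>j. j \<le> m \<Longrightarrow> y j > 0"
    and \<alpha>: "\<And>j. j \<le> m \<Longrightarrow> \<alpha> j = x j / of_nat (y j)" and \<alpha>0: "\<alpha> 0 = 0" and inj: "inj_on \<alpha> {0..m}"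
    and \<beta>: "\<And>j. j \<le> m \<Longrightarrow> \<beta> j \<in> R" "\<exists>j\<le>m. \<beta> j \<noteq> 0"
    and Hs: "\<And>i. i \<in> {1..m} \<Longrightarrow> Hs i \<ge> 1" "\<And>i. i \<in> {1..m} \<Longrightarrow> Hs i \<ge> cmod (\<beta> i)"
    and H: "H = (\<Prod>i=1..m. 2 * real m * Hs i)"
    and H_ge: "H \<ge> exp (gamma_const m x y * ln (gamma_const m x y) / 2)"
    and h_le: "h \<le> g2 m x y"
  shows "cmod (\<Sum>j\<le>m. \<beta> j * exp (\<alpha> j))
           > 1 / (2 * exp (E_const m \<alpha> x y) * H powr (1 + xi m \<alpha> x y H))"
proof -
  define G2 where "G2 = g2 m x y"
  define G4 where "G4 = g4 m x y"
  define v where "v = 1 + g3 m \<alpha>"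
  define g where "g = Lcm (y ` {0..m})"
  define s where "s = sqrt (ln G2)"
  define lam where "lam = ln G4"
  define lG1 where "lG1 = ln (real g)"
  define b where "b = b0 m x y"
  define e where "e = e0 m x y"
  define b' where "b' = b1 m x y"
  define e' where "e' = e1 m \<alpha> x y"
  define z where "z = z_fun (2 * ln H)"
  have xnz: "x j \<noteq> 0" if "j \<in> {1..m}" for j
  proof
    assume "x j = 0"
    then have "\<alpha> j = \<alpha> 0" using \<alpha>[of j] \<alpha>0 that by simp
    then show False using inj_onD[OF inj, of j 0] that by simp
  qed
  have x1: "cmod (x j) \<ge> 1" if "j \<in> {1..m}" for j
    using cmod_ge_1[OF x xnz[OF that]] that by simp
  have y1: "real (y j) \<ge> 1" if "j \<le> m" for j using y[OF that] by simp
  have G2: "cmod (x j) + y j \<le> G2" if "j \<le> m" for j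
    unfolding G2_def g2_def using that by (intro Max_ge) auto
  have G2_2: "G2 \<ge> 2" using G2[of 1] x1[of 1] y1[of 1] m by simp
  have G4: "1 + y j / cmod (x j) \<le> G4" if "j \<in> {1..m}" for j
    unfolding G4_def g4_def using that by (intro Max_ge) auto
  have G4_1: "G4 \<ge> 1" using G4[of 1] m by (auto intro: order.trans[rotated])
  have G42: "G4 \<le> G2"
  proof -
    have "1 + y j / cmod (x j) \<le> G2" if j: "j \<in> {1..m}" for j
    proof -
      have "real (y j) * 1 \<le> y j * cmod (x j)" using x1[OF j] by (intro mult_left_mono) auto
      then have "y j / cmod (x j) \<le> y j" using x1[OF j] by (simp add: divide_le_eq)
      then show ?thesis using x1[OF j] G2[of j] j by simp
    qed
    then show ?thesis unfolding G4_def g4_def using m by (intro Max.boundedI) auto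
  qed
  have g3: "1 + cmod (\<alpha> j) \<le> v" if "j \<le> m" for j
    unfolding v_def g3_def using that by simp
  have v1: "v \<ge> 1" using g3[of 0] \<alpha>0 by simp
  have v2: "v \<le> G2"
  proof -
    have "cmod (\<alpha> j) \<le> G2 - 1" if j: "j \<le> m" for j
    proof -
      have "cmod (\<alpha> j) = cmod (x j) / y j" using \<alpha>[OF j] by (simp add: norm_divide)
      also have "\<dots> \<le> cmod (x j) / 1" using y1[OF j] by (intro divide_left_mono) auto
      finally show ?thesis using G2[OF j] y1[OF j] by simp
    qed
    then have "g3 m \<alpha> \<le> G2 - 1" unfolding g3_def by (intro Max.boundedI) auto
    then show ?thesis by (simp add: v_def)
  qed
  have gdvd: "y j dvd g" if "j \<le> m" for j unfolding g_def using that by (intro dvd_Lcm) auto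
  have g0: "g > 0" unfolding g_def using y by (intro Nat.gr0I) (force simp: Lcm_0_iff)
  have s: "s > 0" "s\<^sup>2 = ln G2" using G2_2 by (simp_all add: s_def)
  have exps: "exp (s\<^sup>2) = G2" using G2_2 by (simp add: s)
  have lns: "ln 2 \<le> s\<^sup>2" using G2_2 by (simp add: s)
  have s23: "s\<^sup>2 \<ge> 2 / 3" using ln2_ge_two_thirds lns by linarith
  have lam: "0 \<le> lam" "lam \<le> s\<^sup>2" using G4_1 G42 by (simp_all add: lam_def s)
  have lnv: "0 \<le> ln v" "ln v \<le> s\<^sup>2" using v1 v2 by (simp_all add: s)
  have lG1: "0 \<le> lG1" "lG1 \<le> (real m + 1) * s\<^sup>2"
  proof -
    show "0 \<le> lG1" using g0 by (simp add: lG1_def)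
    have "g dvd (\<Prod>j\<in>{0..m}. y j)" unfolding g_def
      by (rule Lcm_least) auto
    then have "g \<le> (\<Prod>j\<in>{0..m}. y j)" using y by (intro dvd_imp_le prod_pos) auto
    then have "real g \<le> (\<Prod>j\<in>{0..m}. real (y j))" by (metis of_nat_le_iff of_nat_prod)
    also have "\<dots> \<le> (\<Prod>j\<in>{0..m}. G2)"
    proof (intro prod_mono conjI)
      show "real (y j) \<le> G2" if "j \<in> {0..m}" for j
        using G2[of j] norm_ge_zero[of "x j"] that unfolding atLeastAtMost_iff by linarith
    qed simp
    finally have "lG1 \<le> ln (G2 ^ Suc m)" using g0 unfolding lG1_def by (intro ln_mono) auto
    also have "\<dots> = (real m + 1) * s\<^sup>2" using G2_2 by (simp add: ln_realpow s add.commute del: power_Suc)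
    finally show "lG1 \<le> (real m + 1) * s\<^sup>2" .
  qed
  have b: "b = s + lam / (2 * s)" by (simp add: b_def b0_def s_def lam_def G2_def G4_def)
  have e: "e = b + 2 * s" by (simp add: b e_def e0_def s_def lam_def G2_def G4_def)
  have b'_eq: "b' = max 0 (lG1 - s\<^sup>2 - lam)"
    by (simp add: b'_def b1_def s lam_def G2_def G4_def lG1_def g_def g1_def)
  have e'_eq: "e' = max 0 (lG1 + 2 * ln v + 2 * ln 2 + 1 - s\<^sup>2 - lam)"
    by (simp add: e'_def e1_def s lam_def G2_def G4_def lG1_def g_def g1_def v_def)
  have b': "0 \<le> b'" "b' \<ge> lG1 - s\<^sup>2 - lam" by (simp_all add: b'_eq)
  have e': "0 \<le> e'" "e' \<ge> lG1 + 2 * ln v - s\<^sup>2 - lam" "e' \<le> (real m + 7) * s\<^sup>2"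
  proof -
    show "0 \<le> e'" by (simp add: e'_eq)
    show "e' \<ge> lG1 + 2 * ln v - s\<^sup>2 - lam" using ln2_ge_two_thirds unfolding e'_eq by linarith
    have "(real m + 7) * s\<^sup>2 = (real m + 1) * s\<^sup>2 + 6 * s\<^sup>2" by (simp add: algebra_simps)
    then have "lG1 + 2 * ln v + 2 * ln 2 + 1 - s\<^sup>2 - lam \<le> (real m + 7) * s\<^sup>2"
      using lG1 lnv lns lam s23 by linarith
    then show "e' \<le> (real m + 7) * s\<^sup>2" unfolding e'_eq by simp
  qed
  have b_ge: "b \<ge> s" using lam s by (simp add: b)
  have e_ge: "e \<ge> 3 * s" using b_ge by (simp add: e)

  \<comment> \<open>Size of z and choice of the degree L\<close>
  define U where "U = (3 * real m * e)\<^sup>2"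
  have U1: "U \<ge> 1"
  proof -
    have "1 * (3 * s) \<le> m * e" using m e_ge s by (intro mult_mono) auto
    then have "9 * s \<le> 3 * m * e" by linarith
    then have "(9 * s)\<^sup>2 \<le> U" unfolding U_def using s(1) by (intro power_mono) linarith+
    then show ?thesis using s23 by (simp add: power_mult_distrib)
  qed
  have \<gamma>: "gamma_const m x y = exp U" by (simp add: gamma_const_def U_def e_def)
  have Hj: "1 \<le> 2 * real m * Hs j" if "j \<in> {1..m}" for j
    using mult_mono[of 1 "2 * real m" 1 "Hs j"] Hs(1)[OF that] m by simp
  have Hj0: "0 < 2 * real m * Hs j" if "j \<in> {1..m}" for j
    using Hj[OF that] by linarith
  have Hpos: "H > 0"
    unfolding H by (intro prod_pos Hj0)
  have lnH: "exp U * U \<le> 2 * ln H"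
    using H_ge Hpos unfolding \<gamma> by (subst (asm) ln_ge_iff[symmetric]) auto
  have "exp 1 * 1 \<le> exp U * U" using U1 by (intro mult_mono) auto
  then have t_ge: "exp 1 \<le> 2 * ln H" using lnH by simp
  have z: "z \<ge> exp 1" "z * ln z = 2 * ln H" unfolding z_def using z_fun_props[OF t_ge] by auto
  have z0: "z > 0" using z(1) by (rule less_le_trans[OF exp_gt_zero])
  \<comment> \<open>U is ln \<open>\<gamma>\<close>, and the threshold on H says that z ln z is at
    least \<open>\<gamma>\<close> ln \<open>\<gamma>\<close>; monotonicity gives z at least
    \<open>\<gamma>\<close>.\<close>
  have zU: "ln z \<ge> U"
  proof (rule ccontr)
    assume "\<not> ?thesis"
    then have lnU: "ln z < U" by simp
    then have "z < exp U" using z0 by (metis exp_less_mono exp_ln)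
    then have "z * ln z < exp U * U" using z0 U1 lnU z(1)
      by (intro mult_strict_mono) (auto simp: ln_ge_iff intro: order.trans[rotated])
    then show False using lnH z(2) by simp
  qed
  have lnH0: "ln H > 0" using t_ge exp_gt_zero[of "1::real"] by linarith

  obtain L :: nat where L: "2 \<le> L" "real L \<le> z" "m \<le> L" "s * L > sqrt (ln L)"
    and star: "ln H + m * (L * lG1 + ln (20 * exp (s\<^sup>2) * (L + 1)) + b * L * sqrt (ln L) + v + 2 * L * ln v)
       + (m + 1) * s * L * sqrt (ln L) + (m ^ 3 + m + 1) * ln L \<le> L * ln L"
    and final: "L * lG1 + L * ln L + ln (20 * exp (s\<^sup>2) * (L + 1)) + b * L * sqrt (ln L) + 1
       < ln H + (b + m * e) * (z * sqrt (ln z)) + (1 + b + b' + e' * m) * z + m * ln z"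
    using parameters[OF m s(1) s23 lam b e v1 v2[folded exps] e' b' lG1(1) z0 z(2) zU[unfolded U_def]]
    by blast
  define \<tau> where "\<tau> = sqrt (ln L)"
  have lnL: "ln L > 0" using L(1) by simp
  have \<tau>: "\<tau> > 0" "\<tau> * \<tau> = ln L" using lnL by (simp_all add: \<tau>_def)
  define Q where "Q = ln (20 * G2 * (L + 1))"
  \<comment> \<open>The logarithm of all that a remainder must compensate besides 2 m
    \<open>Hs j\<close>: the denominator \<open>g ^ L\<close>, the size X of the Siegel solution,
    and the factors exp v and \<open>v ^ (2 * L)\<close> of the exponential tail.\<close>
  define XX where "XX = L * lG1 + Q + b * L * \<tau> + v + 2 * L * ln v"
  have Q0: "Q \<ge> 0" unfolding Q_def using G2_2 L(1) mult_mono[of 1 "20 * G2" 1 "1 + real L"]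
    by (intro ln_ge_zero) auto
  have XX0: "XX \<ge> 0"
    unfolding XX_def using lG1(1) Q0 b_ge s \<tau> v1 lnv by (intro add_nonneg_nonneg) auto
  have star': "ln H + m * XX + (m + 1) * s * L * \<tau> + (m ^ 3 + m + 1) * ln L \<le> L * ln L"
    using star unfolding XX_def Q_def \<tau>_def exps .

  \<comment> \<open>The excess of unknowns over equations in Siegel's lemma.\<close>
  define D where "D = nat \<lceil>s * L / \<tau>\<rceil>"
  \<comment> \<open>An excess of at least 2 is what later gives
    \<open>l j + 1 \<le> L\<close>.\<close>
  have sL: "s * L / \<tau> > 1" using L(4) \<tau> by (simp add: \<tau>_def)
  have D: "real D \<ge> s * L / \<tau>" "real D \<le> s * L / \<tau> + 1" "D \<ge> 2"
    using sL unfolding D_def by linarith+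
  \<comment> \<open>The smallest K that satisfies the zero count once the \<open>l j\<close> add up
    to L + 1 - D.\<close>
  define K where "K = D + m * m - 1"
  \<comment> \<open>The quotient is the order at which L^t beats 2 m \<open>Hs j\<close> exp XX;
    adding K makes up for the order lost to at most K derivatives.\<close>
  define lb where "lb j = nat \<lceil>(ln (2 * real m * Hs j) + XX) / ln L\<rceil> + K" for j
  have lb_arg: "0 \<le> (ln (2 * real m * Hs j) + XX) / ln L" if "j \<in> {1..m}" for j
    using Hj[OF that] XX0 lnL by simp
  have lb: "real (lb j) \<le> (ln (2 * real m * Hs j) + XX) / ln L + 1 + K"
     "(ln (2 * real m * Hs j) + XX) / ln L + K \<le> real (lb j)" if "j \<in> {1..m}" for j
    using lb_arg[OF that] unfolding lb_def by linarith+
  define S where "S = (\<Sum>j=1..m. lb j)"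
  have SD: "S + D \<le> L"
  proof -
    have "real S \<le> (\<Sum>j=1..m. (ln (2 * real m * Hs j) + XX) / ln L + 1 + K)"
      unfolding S_def of_nat_sum using lb(1) by (intro sum_mono) auto
    also have "\<dots> = ((\<Sum>j=1..m. ln (2 * real m * Hs j)) + m * XX) / ln L + m + m * K"
      by (simp add: sum.distrib add_divide_distrib flip: sum_divide_distrib)
    also have "(\<Sum>j=1..m. ln (2 * real m * Hs j)) = ln H"
      unfolding H by (intro ln_prod[symmetric]) (use Hj0 in force)+
    finally have 1: "real S \<le> (ln H + m * XX) / ln L + m + m * K" .
    have "real K \<le> s * L / \<tau> + m ^ 2"
      using D(2,3) by (simp add: K_def of_nat_diff power2_eq_square)
    then have "real (m * K) \<le> m * (s * L / \<tau> + m ^ 2)"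
      unfolding of_nat_mult by (rule mult_left_mono) simp
    \<comment> \<open>One s L / \<open>\<tau>\<close> comes from D and one from each of the m copies
      of K. Rounding and the terms m^2 add up to m^3 + m + 1.\<close>
    then have "real S + D \<le> (ln H + m * XX) / ln L + m + m * (s * L / \<tau> + m ^ 2) + s * L / \<tau> + 1"
      using 1 D(2) by linarith
    also have "\<dots> = (ln H + m * XX + (m + 1) * s * L * \<tau> + (m ^ 3 + m + 1) * ln L) / ln L"
      using \<tau>(1) by (simp add: \<tau>(2)[symmetric] field_simps power2_eq_square power3_eq_cube)
    also have "\<dots> \<le> L" using star' lnL by (simp add: divide_le_eq)
    finally show ?thesis by simp
  qed
  \<comment> \<open>The surplus goes to index 1, so that the excess in Siegel's lemma is exactly
    D.\<close>
  define l where "l j = lb j + (if j = 1 then L + 1 - D - S else 0)" for j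
  have suml: "(\<Sum>j=1..m. l j) = L + 1 - D"
  proof -
    have "(\<Sum>j=1..m. l j) = S + (L + 1 - D - S)"
      unfolding l_def sum.distrib S_def using m by (simp add: sum.delta)
    then show ?thesis using SD by simp
  qed
  have l_le: "l j \<le> L + 1 - D" if "j \<in> {1..m}" for j
    using member_le_sum[of j "{1..m}" l] that suml by simp
  define B where "B = exp (b * L * \<tau>)"
  have B1: "B \<ge> 1" unfolding B_def using b_ge s \<tau> by simp
  have Bprod: "(\<Prod>j=1..m. \<Prod>i=1..l j. G2 ^ L * G4 ^ i) \<le> B ^ (L + 1 - (\<Sum>j=1..m. l j))"
  proof -
    define M where "M = L + 1 - D"
    have M: "real M \<le> real L - 1" "M + D = L + 1" using D(3) SD by (simp_all add: M_def of_nat_diff)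
    have "G2 ^ L * G4 ^ i = exp (L * s\<^sup>2 + i * lam)" for i
      using G2_2 G4_1 by (simp add: exp_add exp_of_nat_mult s lam_def)
    then have "(\<Prod>j=1..m. \<Prod>i=1..l j. G2 ^ L * G4 ^ i) = exp (\<Sum>j=1..m. \<Sum>i=1..l j. L * s\<^sup>2 + i * lam)"
      by (simp add: exp_sum)
    also have "\<dots> \<le> exp (real D * (b * L * \<tau>))"
    proof -
      have "(\<Sum>i=1..l j. L * s\<^sup>2 + i * lam) \<le> l j * (L * s\<^sup>2 + L / 2 * lam)" if j: "j \<in> {1..m}" for j
      proof -
        have "(\<Sum>i=1..l j. L * s\<^sup>2 + i * lam) = l j * (L * s\<^sup>2) + (\<Sum>i=1..l j. real i) * lam"
          by (simp add: sum.distrib sum_distrib_right)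
        also have "(\<Sum>i=1..n. real i) = real n * (real n + 1) / 2" for n
          by (induction n) (simp_all add: field_simps)
        \<comment> \<open>Summing i up to \<open>l j\<close> yields the factor 1/2 in front of ln g4
          in b0.\<close>
        also have "real (l j) * (real (l j) + 1) / 2 * lam \<le> real (l j) * L / 2 * lam"
        proof -
          have "real (l j) + 1 \<le> L" using l_le[OF j] D(3) SD by simp
          then have "real (l j) * (real (l j) + 1) \<le> real (l j) * L" by (rule mult_left_mono) simp
          then show ?thesis using lam(1) by (intro mult_right_mono divide_right_mono) auto
        qed
        finally show ?thesis by (simp add: algebra_simps)
      qed
      then have "(\<Sum>j=1..m. \<Sum>i=1..l j. L * s\<^sup>2 + i * lam) \<le> (\<Sum>j=1..m. l j * (L * s\<^sup>2 + L / 2 * lam))"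
        by (rule sum_mono)
      also have "\<dots> = M * (L * s\<^sup>2 + L / 2 * lam)"
        using suml by (simp add: M_def flip: sum_distrib_right of_nat_sum)
      also have "\<dots> \<le> L * (L * s\<^sup>2 + L / 2 * lam)"
        using M lam by (intro mult_right_mono) auto
      \<comment> \<open>This identity is the origin of b0: s b = s^2 + lam / 2, so division by D
        leaves at most b L \<open>\<tau>\<close>.\<close>
      also have "\<dots> = s * L * (b * L)"
        using s(1) by (simp add: b field_simps power2_eq_square)
      also have "\<dots> \<le> D * \<tau> * (b * L)"
        using D(1) \<tau> b_ge s by (intro mult_right_mono) (auto simp: divide_le_eq)
      finally show ?thesis by (simp add: mult_ac)
    qed
    also have "\<dots> = B ^ D" by (simp add: B_def exp_of_nat_mult)
    finally show ?thesis using suml D(3) SD by simp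
  qed

  \<comment> \<open>Size of the approximations and of the remainders\<close>
  define X where "X = 10 * (1 + h) * (L + 1) * B"
  have X0: "X > 0" using Im_omega_pos B1 by (simp add: X_def)
  have X_le: "X \<le> exp (Q + b * L * \<tau>)"
  proof -
    have eq: "exp (Q + b * L * \<tau>) = 20 * G2 * (L + 1) * B"
      using G2_2 by (simp add: exp_add Q_def B_def)
    have "10 * (1 + h) \<le> 20 * G2" using h_le G2_2 by (simp add: G2_def)
    then show ?thesis unfolding X_def eq using B1 by (intro mult_right_mono) auto
  qed
  have G2_1: "1 \<le> G2" using G2_2 by simp
  have K': "K + 1 + (\<Sum>j=1..m. l j) > L + m * m" "K \<ge> m" "\<And>j. j \<in> {1..m} \<Longrightarrow> K \<le> l j"
    "(\<Sum>j=1..m. l j) \<le> L"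
  proof -
    show "K + 1 + (\<Sum>j=1..m. l j) > L + m * m" "(\<Sum>j=1..m. l j) \<le> L"
      unfolding suml using D(3) SD by (simp_all add: K_def)
    have "m \<le> m * m" using m by simp
    then show "K \<ge> m" using D(3) unfolding K_def by linarith
    show "K \<le> l j" for j by (simp add: l_def lb_def)
  qed
  obtain k q r where k: "k \<le> K" and q: "cmod q \<le> fact L * X * exp 1"
    and r: "\<And>j. j \<in> {1..m} \<Longrightarrow>
      cmod (r j) \<le> fact L * X * (v ^ (L + l j - k + 1) / fact (L + l j - k + 1) * exp v)"
    and one: "1 \<le> real g ^ L * cmod (q * (\<Sum>j\<le>m. \<beta> j * exp (\<alpha> j)) - (\<Sum>j=1..m. \<beta> j * r j))"
    by (rule exp_approximations[OF x y \<alpha> \<alpha>0 inj \<beta> g0 gdvd G2 G2_1 G4 G4_1 g3 K'(4) L(3) K'(1,2,3) B1 Bprod,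
          folded X_def]) (assumption | rule that)+
  define \<Lambda> where "\<Lambda> = (\<Sum>j\<le>m. \<beta> j * exp (\<alpha> j))"
  have r_small: "real g ^ L * cmod (\<beta> j * r j) \<le> 1 / (2 * real m)" if j: "j \<in> {1..m}" for j
  proof -
    \<comment> \<open>The remainder starts at index L + t. Here t at most L bounds the power of v by
      2 L, and t at least \<open>lb j - K\<close> gives the required gain.\<close>
    define t where "t = l j - k + 1"
    have t: "L + l j - k + 1 = L + t" "t \<le> L" "lb j - K \<le> t"
    proof -
      have "lb j \<le> l j" by (simp add: l_def)
      then show "L + l j - k + 1 = L + t" "t \<le> L" "lb j - K \<le> t"
        using k K'(3)[OF j] l_le[OF j] D(3) SD unfolding t_def by linarith+
    qed
    have lb_t: "(ln (2 * real m * Hs j) + XX) / ln L \<le> t"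
    proof -
      have "real (lb j - K) = real (lb j) - K" by (simp add: lb_def)
      then show ?thesis using lb(2)[OF j] t(3) by linarith
    qed
    have Lt: "2 * real m * Hs j * exp XX \<le> real L ^ t"
    proof -
      have "2 * real m * Hs j * exp XX = exp (ln (2 * real m * Hs j) + XX)"
        by (simp only: exp_add exp_ln[OF Hj0[OF j]])
      also have "\<dots> \<le> exp (t * ln L)"
        using lb_t lnL by (simp add: divide_le_eq)
      also have "\<dots> = real L ^ t" using L(1) by (simp add: exp_of_nat_mult)
      finally show ?thesis .
    qed
    have "fact L * real L ^ t \<le> fact (L + t)"
      using fact_mult_power_le[of L "L + t"]
      by (metis add_diff_cancel_left' le_add1 of_nat_fact of_nat_le_iff of_nat_mult of_nat_power)
    then have "fact L * (2 * real m * Hs j * exp XX) \<le> (fact (L + t) :: real)"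
      using Lt by (elim order.trans[rotated]) (intro mult_left_mono, auto)
    moreover define Y where "Y = 2 * real m * Hs j * exp XX"
    ultimately have "fact L * Y \<le> (fact (L + t) :: real)" by simp
    moreover have Y: "Y > 0" using Hj0[OF j] by (simp only: Y_def mult_pos_pos exp_gt_zero)
    ultimately have F: "fact L / fact (L + t) \<le> 1 / Y"
      by (simp add: field_simps)
    have "cmod (r j) \<le> fact L * X * (v ^ (L + t) / fact (L + t) * exp v)"
      using r[OF j] unfolding t(1) .
    also have "\<dots> = fact L / fact (L + t) * (X * v ^ (L + t) * exp v)" by simp
    also have "\<dots> \<le> 1 / Y * (exp (Q + b * L * \<tau>) * v ^ (2 * L) * exp v)"
      using F X0 X_le v1 t(2) Y
      by (intro mult_mono power_increasing) (auto intro!: mult_nonneg_nonneg)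
    also have "exp (Q + b * L * \<tau>) * v ^ (2 * L) * exp v = exp (XX - L * lG1)"
    proof -
      have "v ^ (2 * L) = exp (2 * L * ln v)" using v1 by (simp add: exp_of_nat_mult flip: of_nat_mult)
      then show ?thesis by (simp add: XX_def flip: exp_add)
    qed
    also have "exp (XX - L * lG1) = exp XX / real g ^ L"
      using g0 by (simp add: exp_diff lG1_def exp_of_nat_mult)
    also have "1 / Y * (exp XX / real g ^ L) = 1 / (2 * real m * Hs j) / real g ^ L"
      by (simp add: Y_def)
    finally have "real g ^ L * cmod (r j) \<le> real g ^ L * (1 / (2 * real m * Hs j) / real g ^ L)"
      by (rule mult_left_mono) simp
    also have "\<dots> = 1 / (2 * real m * Hs j)" using g0 by simp
    finally have "real g ^ L * cmod (r j) \<le> 1 / (2 * real m * Hs j)" .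
    then have "cmod (\<beta> j) * (real g ^ L * cmod (r j)) \<le> Hs j * (1 / (2 * real m * Hs j))"
      using Hs[OF j] by (intro mult_mono) auto
    also have "\<dots> = 1 / (2 * real m)" using Hs(1)[OF j] by simp
    finally show ?thesis by (simp add: norm_mult mult_ac)
  qed
  \<comment> \<open>The m remainders contribute at most 1/2 to an integral value of modulus at least
    1, so the linear form supplies the rest.\<close>
  have half: "1 / 2 \<le> real g ^ L * (cmod q * cmod \<Lambda>)"
  proof -
    have "1 \<le> real g ^ L * (cmod (q * \<Lambda>) + cmod (\<Sum>j=1..m. \<beta> j * r j))"
      using one norm_triangle_ineq4[of "q * \<Lambda>" "\<Sum>j=1..m. \<beta> j * r j"] unfolding \<Lambda>_def
      by (elim order.trans) (intro mult_left_mono, auto)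
    also have "\<dots> \<le> real g ^ L * (cmod (q * \<Lambda>) + (\<Sum>j=1..m. cmod (\<beta> j * r j)))"
      by (intro mult_left_mono add_left_mono norm_sum) auto
    also have "\<dots> = real g ^ L * (cmod q * cmod \<Lambda>) + (\<Sum>j=1..m. real g ^ L * cmod (\<beta> j * r j))"
      by (simp add: norm_mult sum_distrib_left algebra_simps)
    also have "(\<Sum>j=1..m. real g ^ L * cmod (\<beta> j * r j)) \<le> (\<Sum>j=1..m. 1 / (2 * real m))"
      using r_small by (rule sum_mono)
    also have "(\<Sum>j=1..m. 1 / (2 * real m)) = 1 / 2" using m by simp
    finally show ?thesis by simp
  qed
  \<comment> \<open>The terms are the logarithms of \<open>g ^ L\<close>, of L^L as a bound for L!,
    of X, and of the factor e in the bound for q.\<close>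
  define W where "W = L * lG1 + L * ln L + Q + b * L * \<tau> + 1"
  have gq: "real g ^ L * cmod q \<le> exp W"
  proof -
    have "real g ^ L * cmod q \<le> real g ^ L * (real L ^ L * exp (Q + b * L * \<tau>) * exp 1)"
    proof (intro mult_left_mono order.trans[OF q] mult_right_mono mult_mono)
      show "fact L \<le> real L ^ L" using fact_le_power[of L, where 'a = real] by simp
    qed (use X_le X0 in auto)
    also have "\<dots> = exp W"
      using g0 L(1) by (simp add: W_def exp_add lG1_def exp_of_nat_mult)
    finally show ?thesis .
  qed
  have W_less: "W < E_const m \<alpha> x y + ln H * (1 + xi m \<alpha> x y H)"
  proof -
    \<comment> \<open>Because z ln z = 2 ln H, multiplying xi by ln H turns it into an expression in
      z and ln z that can be compared with the outcome of \<open>parameters\<close>.\<close>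
    have 1: "sqrt (2 * (z / ln H)) * ln H = z * sqrt (ln z)"
    proof -
      have "sqrt (2 * (z / ln H)) * ln H = sqrt (2 * (z / ln H) * (ln H)\<^sup>2)"
        using lnH0 by (simp only: real_sqrt_mult real_sqrt_abs abs_of_pos)
      also have "2 * (z / ln H) * (ln H)\<^sup>2 = z * (2 * ln H)"
        using lnH0 by (simp add: power2_eq_square)
      also have "\<dots> = z\<^sup>2 * ln z" unfolding z(2)[symmetric] by (simp add: power2_eq_square)
      also have "sqrt (z\<^sup>2 * ln z) = z * sqrt (ln z)"
        using z0 by (simp only: real_sqrt_mult real_sqrt_abs abs_of_pos)
      finally show ?thesis .
    qed
    have "ln H * xi m \<alpha> x y H = A_const m x y * (sqrt (2 * (z / ln H)) * ln H)
        + B_const m \<alpha> x y * z + C_const m * ln z + D_const m x y * sqrt (ln z)"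
      unfolding xi_def z_def[symmetric] using lnH0 by (simp add: field_simps)
    also have "\<dots> = (b + m * e) * (z * sqrt (ln z)) + (1 + b + b' + e' * m) * z + m * ln z
        + D_const m x y * sqrt (ln z)"
      unfolding 1 A_const_def B_const_def C_const_def
      by (simp add: b_def e_def b'_def e'_def mult.commute)
    finally have xi: "ln H * (1 + xi m \<alpha> x y H) = ln H + ((b + m * e) * (z * sqrt (ln z))
        + (1 + b + b' + e' * m) * z + m * ln z + D_const m x y * sqrt (ln z))"
      by (simp add: algebra_simps)
    have "0 \<le> D_const m x y * sqrt (ln z)"
      unfolding D_const_def b_def[symmetric] e_def[symmetric]
      using b_ge e_ge s zU U1 by (intro mult_nonneg_nonneg add_nonneg_nonneg) auto
    moreover have "0 \<le> E_const m \<alpha> x y"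
      unfolding E_const_def b_def[symmetric] e_def[symmetric] b'_def[symmetric] e'_def[symmetric]
      using b_ge e_ge s b' e' by (intro mult_nonneg_nonneg add_nonneg_nonneg) auto
    ultimately show ?thesis
      using final unfolding W_def Q_def \<tau>_def exps xi by linarith
  qed
  have "1 / 2 \<le> exp W * cmod \<Lambda>"
    using half mult_right_mono[OF gq, of "cmod \<Lambda>"] by (simp add: mult.assoc)
  then have "1 / (2 * exp W) \<le> cmod \<Lambda>" by (simp add: field_simps)
  moreover have "1 / (2 * exp (E_const m \<alpha> x y) * H powr (1 + xi m \<alpha> x y H)) < 1 / (2 * exp W)"
  proof -
    have "2 * exp (E_const m \<alpha> x y) * H powr (1 + xi m \<alpha> x y H)
        = 2 * exp (E_const m \<alpha> x y + ln H * (1 + xi m \<alpha> x y H))"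
      using Hpos by (simp add: powr_def exp_add mult.commute)
    then show ?thesis using W_less by (simp add: frac_less2)
  qed
  ultimately show ?thesis unfolding \<Lambda>_def by linarith
qed

end

text \<open>Rational integers lie in Z[i], where h = 1 is at most g2. This serves the rational field
  and also fields of large discriminant.\<close>

lemma linear_form_lower_bound_Ints:
  fixes m :: nat and \<alpha> x \<beta> :: "nat \<Rightarrow> complex" and y :: "nat \<Rightarrow> nat"
    and Hs :: "nat \<Rightarrow> real" and H :: real
  assumes "m \<ge> 2"
    and x: "\<And>j. j \<le> m \<Longrightarrow> x j \<in> \<int>" and y: "\<And>j. j \<le> m \<Longrightarrow> y j > 0"
    and "\<And>j. j \<le> m \<Longrightarrow> \<alpha> j = x j / of_nat (y j)" and "\<alpha> 0 = 0" and "inj_on \<alpha> {0..m}"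
    and \<beta>: "\<And>j. j \<le> m \<Longrightarrow> \<beta> j \<in> \<int>" and "\<exists>j\<le>m. \<beta> j \<noteq> 0"
    and "\<And>i. i \<in> {1..m} \<Longrightarrow> Hs i \<ge> 1" and "\<And>i. i \<in> {1..m} \<Longrightarrow> Hs i \<ge> cmod (\<beta> i)"
    and "H = (\<Prod>i=1..m. 2 * real m * Hs i)"
    and "H \<ge> exp (gamma_const m x y * ln (gamma_const m x y) / 2)"
    and g2: "1 \<le> g2 m x y"
  shows "cmod (\<Sum>j\<le>m. \<beta> j * exp (\<alpha> j))
           > 1 / (2 * exp (E_const m \<alpha> x y) * H powr (1 + xi m \<alpha> x y H))"
proof -
  interpret quadratic_order \<i> 0 1 by unfold_locales auto
  have Ints_R: "u \<in> R" if "u \<in> \<int>" for u using that by (auto elim: Ints_cases)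
  show ?thesis
    by (rule linear_form_lower_bound[where x = x and y = y and Hs = Hs and H = H])
      (use assms in \<open>simp_all add: Ints_R\<close>)
qed

theorem theorem2p1:
  fixes m :: nat and K :: base_field
    and \<alpha> x \<beta> :: "nat \<Rightarrow> complex" and y :: "nat \<Rightarrow> nat"
    and Hs :: "nat \<Rightarrow> real" and H :: real
  assumes "m \<ge> 2"
    and "valid_field K"
    and "\<forall>j\<in>{0..m}. \<alpha> j \<in> field_elems K"
    and "\<alpha> 0 = 0"
    and "inj_on \<alpha> {0..m}"
    and "\<forall>j\<in>{0..m}. reduced_fraction K (\<alpha> j) (x j) (y j)"
    and "\<forall>i\<in>{0..m}. \<beta> i \<in> field_integers K"
    and "\<exists>i\<in>{0..m}. \<beta> i \<noteq> 0"
    and "\<forall>i\<in>{1..m}. Hs i \<ge> max 1 (cmod (\<beta> i))"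
    and "H = (\<Prod>i=1..m. 2 * real m * Hs i)"
    and "H \<ge> H0 K m x y"
  shows "cmod (\<beta> 0 + (\<Sum>i=1..m. \<beta> i * exp (\<alpha> i)))
           > 1 / (2 * exp (E_const m \<alpha> x y) * H powr (1 + xi m \<alpha> x y H))"
proof -
  let ?bound = "1 / (2 * exp (E_const m \<alpha> x y) * H powr (1 + xi m \<alpha> x y H))"
  have xK: "x j \<in> field_integers K" and y: "y j > 0" and \<alpha>: "\<alpha> j = x j / of_nat (y j)" if "j \<le> m" for j
    using assms(6) that by (auto simp: reduced_fraction_def)
  have \<beta>K: "\<beta> j \<in> field_integers K" if "j \<le> m" for j using assms(7) that by simp
  have \<beta>0: "\<exists>j\<le>m. \<beta> j \<noteq> 0" using assms(8) by auto
  have Hs: "Hs i \<ge> 1" "Hs i \<ge> cmod (\<beta> i)" if "i \<in> {1..m}" for i using assms(9) that by auto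
  have H_ge: "H \<ge> exp (gamma_const m x y * ln (gamma_const m x y) / 2)"
    using assms(11) by (simp add: H0_def)
  have x_le: "cmod (x j) + 1 \<le> g2 m x y" if "j \<le> m" for j
  proof -
    have "cmod (x j) + y j \<le> g2 m x y" unfolding g2_def using that by (intro Max_ge) auto
    then show ?thesis using y[OF that] by simp
  qed
  have g2: "1 \<le> g2 m x y" using x_le[of 0] norm_ge_zero[of "x 0"] by linarith
  have sum_eq: "\<beta> 0 + (\<Sum>i=1..m. \<beta> i * exp (\<alpha> i)) = (\<Sum>j\<le>m. \<beta> j * exp (\<alpha> j))"
    using assms(4) by (simp add: atMost_atLeast0 sum.atLeast_Suc_atMost)
  \<comment> \<open>Stated for other coefficients of no larger modulus, so that the same
    \<open>Hs\<close> and H apply when the form is replaced by the one formed by imaginary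
    parts.\<close>
  have Ints: "cmod (\<Sum>j\<le>m. \<beta>' j * exp (\<alpha> j)) > ?bound"
    if "\<And>j. j \<le> m \<Longrightarrow> x j \<in> \<int>" "\<And>j. j \<le> m \<Longrightarrow> \<beta>' j \<in> \<int>" "\<exists>j\<le>m. \<beta>' j \<noteq> 0"
      "\<And>i. i \<in> {1..m} \<Longrightarrow> cmod (\<beta>' i) \<le> cmod (\<beta> i)" for \<beta>'
  proof -
    have "Hs i \<ge> cmod (\<beta>' i)" if "i \<in> {1..m}" for i
      using Hs(2)[OF that] \<open>\<And>i. i \<in> {1..m} \<Longrightarrow> cmod (\<beta>' i) \<le> cmod (\<beta> i)\<close>[OF that] by linarith
    then show ?thesis
      using that(1-3) Hs(1)
      by (intro linear_form_lower_bound_Ints[OF assms(1) _ y \<alpha> assms(4,5) _ _ _ _ assms(10) H_ge g2]) auto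
  qed
  have "cmod (\<Sum>j\<le>m. \<beta> j * exp (\<alpha> j)) > ?bound"
  proof (cases K)
    case Rational_Field
    then show ?thesis
      using xK \<beta>K field_integers_Rational \<beta>0 by (intro Ints) auto
  next
    case (Imaginary_Quadratic d)
    then have d: "d > 0" "squarefree d" using assms(2) by auto
    interpret quadratic_order "order_gen d" "if d mod 4 = 3 then 1 else 0"
        "if d mod 4 = 3 then (1 + int d) div 4 else int d"
      using quadratic_order_order_gen[OF d(1)] .
    have xR: "x j \<in> R" and \<beta>R: "\<beta> j \<in> R" if "j \<le> m" for j
      using field_integers_subset_R[OF d] xK[OF that] \<beta>K[OF that] Imaginary_Quadratic by auto
    show ?thesis
    proof (cases "h \<le> g2 m x y")
      case True
      show ?thesis
        by (rule linear_form_lower_bound[OF assms(1) xR y \<alpha> assms(4,5) \<beta>R \<beta>0 Hs assms(10) H_ge True])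
    next
      case False
      txt \<open>The field may have a huge discriminant here, which the constants do not see. But then all
        \<open>\<alpha> j\<close> are rational, and the imaginary part of the form is a form with rational integer
        coefficients.\<close>
      have x_int: "x j \<in> \<int>" if j: "j \<le> m" for j
      proof -
        obtain k :: int where k: "Im (x j) = of_int k * h" using Im_R xR[OF j] by blast
        have "\<bar>of_int k\<bar> * h = \<bar>Im (x j)\<bar>" using Im_omega_pos k by (simp add: abs_mult)
        also have "\<dots> < 1 * h" using abs_Im_le_cmod[of "x j"] x_le[OF j] False by linarith
        finally have "\<bar>of_int k\<bar> < (1::real)" using Im_omega_pos mult_less_cancel_right_pos by blast
        then have "k = 0" by simp
        then show ?thesis using k xR[OF j] by (auto elim: Im_0_R)
      qed
      have "\<exists>w. \<forall>j. j \<le> m \<longrightarrow> Im (\<beta> j) = of_int (w j) * h"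
        using Im_R \<beta>R by (intro choice) blast
      then obtain w :: "nat \<Rightarrow> int" where w: "\<And>j. j \<le> m \<Longrightarrow> Im (\<beta> j) = of_int (w j) * h" by blast
      show ?thesis
      proof (cases "\<forall>j\<le>m. w j = 0")
        case True
        then have "\<beta> j \<in> \<int>" if "j \<le> m" for j
          using w[OF that] \<beta>R[OF that] that by (auto elim: Im_0_R)
        then show ?thesis using x_int \<beta>0 by (intro Ints) auto
      next
        case False': False
        \<comment> \<open>With h at least 1, the integers \<open>w i\<close> are bounded by
          |\<open>\<beta> i\<close>|, and the form with coefficients \<open>w i\<close> is bounded
          by the imaginary part of the original form, since all exponentials are real.\<close>
        have h1: "h \<ge> 1" using False g2 by simp
        have exp_real: "exp (\<alpha> j) = of_real (exp (Re (\<alpha> j)))" if "j \<le> m" for j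
        proof -
          have "\<alpha> j \<in> \<real>" using x_int[OF that] \<alpha>[OF that] by (auto elim!: Ints_cases)
          then have "\<alpha> j = of_real (Re (\<alpha> j))" by (simp add: of_real_Re)
          then show ?thesis by (metis exp_of_real)
        qed
        have "?bound < cmod (\<Sum>j\<le>m. of_int (w j) * exp (\<alpha> j))"
        proof (rule Ints)
          fix i assume i: "i \<in> {1..m}"
          have "cmod (of_int (w i)) * 1 \<le> \<bar>of_int (w i)\<bar> * h" unfolding norm_of_int
            using h1 by (intro mult_left_mono) auto
          also have "\<dots> = \<bar>Im (\<beta> i)\<bar>" using w[of i] i Im_omega_pos by (simp add: abs_mult)
          also have "\<dots> \<le> cmod (\<beta> i)" by (rule abs_Im_le_cmod)
          finally show "cmod (of_int (w i)) \<le> cmod (\<beta> i)" by simp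
        qed (use x_int False' in auto)
        also have "(\<Sum>j\<le>m. of_int (w j) * exp (\<alpha> j))
            = complex_of_real (\<Sum>j\<le>m. of_int (w j) * exp (Re (\<alpha> j)))"
          unfolding of_real_sum by (intro sum.cong) (auto simp: exp_real)
        also have "cmod \<dots> * 1 \<le> \<bar>\<Sum>j\<le>m. of_int (w j) * exp (Re (\<alpha> j))\<bar> * h"
          unfolding norm_of_real using h1 by (intro mult_left_mono) auto
        also have "\<dots> = \<bar>Im (\<Sum>j\<le>m. \<beta> j * exp (\<alpha> j))\<bar>"
        proof -
          have "Im (\<Sum>j\<le>m. \<beta> j * exp (\<alpha> j)) = (\<Sum>j\<le>m. of_int (w j) * exp (Re (\<alpha> j))) * h"
            unfolding Im_sum sum_distrib_right
            by (intro sum.cong) (auto simp: exp_real w)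
          then show ?thesis using Im_omega_pos by (simp add: abs_mult)
        qed
        also have "\<dots> \<le> cmod (\<Sum>j\<le>m. \<beta> j * exp (\<alpha> j))" by (rule abs_Im_le_cmod)
        finally show ?thesis by simp
      qed
    qed
  qed
  then show ?thesis unfolding sum_eq .
qed

end
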